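(* Let $f_0:\mathbb{R}^n\to\mathbb{R}^n$ be a mapping that is Lipschitz in a neighborhood of $x_0\in\mathbb{R}^n$, such that $\partial f_0(x_0)$ is of maximal rank and, in this neighborhood, $f_0$ satisfies $$K\|x-y\|\le\|f_0(x)-f_0(y)\|\le K'\|x-y\|.$$ Let $f=f_0+h$, where $h:\mathbb{R}^n\to\mathbb{R}^n$ is a Lipschitz mapping with Lipschitz constant $L$ such that $L<K$. Set $$\delta=\frac12\inf_{M_0\in\partial f(x_0)}\frac{1}{\|M_0^{-1}\|}.$$ Suppose that $r>0$ was chosen so that, in $\mathbf{B}^n_r(x_0)$, $f$ satisfies a Lipschitz condition (there is a constant $C$ with $\|f(x)-f(y)\|\le C\|x-y\|$ for all $x,y\in\mathbf{B}^n_r(x_0)$) and $\partial f(x)\subset\partial f(x_0)+\delta\,\mathcal{B}_{n\times n}$. Then there exist neighborhoods $U$ and $V$ of $x_0$ and $f(x_0)$, respectively, and a Lipschitz mapping $g:V\to\mathbb{R}^n$ such that (a) $g(f(u))=u$ for every $u\in U$; (b) $f(g(v))=v$ for every $v\in V$. Moreover, $U$, $V$ and the Lipschitz constant $L(g)$ of $g$ are determined by $$U=\mathbf{B}^n_{\frac{r\delta}{2}\cdot\frac{1}{K'+L}}(x_0),\qquad V=\mathbf{B}^n_{\frac{r\delta}{2}}(f(x_0)),\qquad L(g)=\frac1\delta.$$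
   Context: $\|\cdot\|$ on $\mathbb{R}^n$ is the Euclidean norm, and for a matrix $A$, $\|A\|=\max_{\|x\|=1}\|Ax\|$ is the operator norm. $\mathbf{B}^n_\rho(a)$ is the ball of radius $\rho$ centered at $a\in\mathbb{R}^n$. $\mathcal{B}_{n\times n}$ is the unit ball of the space of real $n\times n$ matrices with the operator norm; sums of sets are Minkowski sums. $L(g)$ (not to be confused with the number $L$, the Lipschitz constant of $h$) denotes the Lipschitz constant of a mapping $g$, defined by $L(g)=\sup\left\{\frac{\|g(x)-g(y)\|}{\|x-y\|}: x\ne y\right\}$, with $x,y$ ranging over the domain of $g$. For a mapping $f$ that is Lipschitz near a point $x$ (hence differentiable almost everywhere near $x$ by Rademacher's theorem), $Jf$ denotes the usual Jacobian matrix where it exists. The generalized Jacobian $\partial f(x)$ (Clarke) is the convex hull of all matrices of the form $\lim_{i\to\infty}Jf(x_i)$, where $x_i\to x$ and $f$ is differentiable at each $x_i$. $\partial f_0(x_0)$ is said to be of maximal rank if every matrix $M\in\partial f_0(x_0)$ has maximal rank (here: is invertible).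
   Formalization: Added: every M0 in ∂f(x0) is invertible (so that δ is defined), and U lies in the neighborhood where f0 satisfies the K, K' estimate; L(g)=1/δ is corrected to L(g)≤1/δ (for f0=id, h=0 one has L(g)=1 but 1/δ=2). *)

theory Defs
  imports "HOL-Analysis.Analysis"
begin

text \<open>Clarke's generalized Jacobian. The convergence of matrices is that of \<^typ>\<open>real^'n^'n\<close>
  (equivalently, convergence in operator norm). Intended for maps that are Lipschitz near \<open>x\<close>.\<close>

definition generalized_jacobian :: "(real^'n \<Rightarrow> real^'n) \<Rightarrow> real^'n \<Rightarrow> (real^'n^'n) set"
  where "generalized_jacobian f x = convex hull
    {M. \<exists>X. (\<forall>i::nat. f differentiable (at (X i))) \<and> X \<longlonglongrightarrow> x \<and>
          (\<lambda>i. jacobian f (at (X i))) \<longlonglongrightarrow> M}"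

definition maximal_rank :: "(real^'n^'n) set \<Rightarrow> bool"
  where "maximal_rank S \<longleftrightarrow> (\<forall>M\<in>S. invertible M)"

definition matrix_norm :: "real^'n^'n \<Rightarrow> real"
  where "matrix_norm A = onorm (\<lambda>x. A *v x)"

definition matrix_unit_ball :: "(real^'n^'n) set"
  where "matrix_unit_ball = {A. matrix_norm A \<le> 1}"

text \<open>Meaningful only if the quotients are bounded, i.e. if \<open>g\<close> is Lipschitz on \<open>S\<close>, and \<open>S\<close> has
  at least two points; otherwise the real supremum is a junk value.\<close>

definition lipschitz_constant :: "(real^'n) set \<Rightarrow> (real^'n \<Rightarrow> real^'n) \<Rightarrow> real"
  where "lipschitz_constant S g =
    Sup {norm (g x - g y) / norm (x - y) | x y. x \<in> S \<and> y \<in> S \<and> x \<noteq> y}"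

end

theory Submission
  imports Defs
begin

text \<open>For each unit vector \<open>u\<close> the compact convex set \<open>{M u | M \<in> \<partial>f(x0)}\<close> has distance at least
  \<open>2 \<delta>\<close> from the origin, so some unit vector \<open>w\<close> satisfies \<open>w \<bullet> J u \<ge> \<delta>\<close> for every Jacobian \<open>J\<close> of \<open>f\<close>
  at a point of the ball. By Rademacher's theorem these Jacobians exist almost everywhere, and
  integrating over translates of a segment yields \<open>\<delta> |x - y| \<le> |f x - f y|\<close> on the ball. Invariance of
  domain and a connectedness argument turn this lower bound into surjectivity onto \<open>V\<close>.

  Rademacher's theorem is reduced to one dimension by Fubini; there it is the Vitali covering
  argument comparing Lebesgue measure with the Stieltjes measure of \<open>f\<close>. Additivity of the
  directional derivative in the direction holds after integration over every box, hence almost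
  everywhere.\<close>

section \<open>Difference quotients\<close>

text \<open>A segment is a null set, and \<open>f\<close> may be nondifferentiable at every point of
  it, so almost everywhere information on Jacobians says nothing about that one segment. This
  obstacle forces the detour through nearby translates and through Rademacher's theorem. What keeps
  the detour scalar is that \<open>w\<close> depends on the direction \<open>u\<close> alone and
  serves all points of the ball: only the real function \<open>w \<bullet> f\<close> has to be
  estimated, and convexity of the generalized Jacobian is what provides a common \<open>w\<close>.

  The factor 1/2 in \<delta> is a budget. Every matrix at \<open>x0\<close> stretches unit vectors
  by at least 2 \<delta>, the permitted perturbation spends at most \<delta>, and \<delta> remains
  as the expansion rate of \<open>f\<close>. Compactness of the generalized Jacobian together with
  invertibility makes \<delta> positive.

  The radii come from the half ball: its boundary is sent at least \<delta> r / 2 away from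
  \<open>f x0\<close>, which is the radius of \<open>V\<close>; dividing by the upper growth rate K'
  + L gives the radius of \<open>U\<close>. The value 1 / \<delta> for the Lipschitz constant of the
  inverse is proved as an upper bound.\<close>

lemma AE_lborel_translation:
  fixes a :: "'a::euclidean_space"
  assumes "AE z in lborel. P z"
  shows "AE z in lborel. P (z + a)"
proof -
  obtain N where N: "N \<in> null_sets lborel" "{z. \<not> P z} \<subseteq> N"
    using assms by (auto simp: eventually_ae_filter)
  have "{x. x - (- a) \<in> N} \<in> null_sets lborel"
    using N(1) by (rule null_sets_translation)
  moreover have "{z. \<not> P (z + a)} \<subseteq> {x. x - (- a) \<in> N}"
    using N(2) by auto
  ultimately show ?thesis
    by (auto simp: eventually_ae_filter)
qed

lemma integral_lborel_translation:
  fixes g :: "'a::euclidean_space \<Rightarrow> real"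
  assumes [measurable]: "g \<in> borel_measurable borel"
  shows "(\<integral>z. g (z + a) \<partial>lborel) = (\<integral>z. g z \<partial>lborel)"
proof -
  have "(\<integral>z. g z \<partial>lborel) = (\<integral>z. g z \<partial>(distr lborel borel ((+) a)))"
    by (simp add: lborel_distr_plus)
  also have "\<dots> = (\<integral>z. g (a + z) \<partial>lborel)"
    by (subst integral_distr) auto
  finally show ?thesis by (simp add: add.commute)
qed

text \<open>The limit is the supremum of all eventual lower bounds. Slightly below it lies such a
  bound; slightly above it there is none, so the gap hypothesis must deliver its other alternative,
  an eventual upper bound.\<close>

lemma tendsto_of_no_oscillation:
  fixes g :: "'a \<Rightarrow> real"
  assumes F: "F \<noteq> bot" and bdd: "\<forall>\<^sub>F x in F. \<bar>g x\<bar> \<le> B"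
    and gap: "\<And>p q. p < q \<Longrightarrow> (\<forall>\<^sub>F x in F. p \<le> g x) \<or> (\<forall>\<^sub>F x in F. g x \<le> q)"
  shows "\<exists>l. (g \<longlongrightarrow> l) F"
proof -
  define P where "P = {p. \<forall>\<^sub>F x in F. p \<le> g x}"
  define l where "l = Sup P"
  have "- B \<in> P"
    unfolding P_def using bdd by (auto elim: eventually_mono)
  have le: "p \<le> B" if "p \<in> P" for p
  proof -
    have "\<forall>\<^sub>F x in F. p \<le> B"
      using that bdd unfolding P_def mem_Collect_eq by eventually_elim auto
    then show ?thesis using F by (simp add: eventually_const)
  qed
  have bddP: "bdd_above P" using le by (auto simp: bdd_above_def)
  have "(g \<longlongrightarrow> l) F"
  proof (rule tendstoI)
    fix e :: real assume "e > 0"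
    obtain p where "p \<in> P" "l - e/2 < p"
      using less_cSupE[of "l - e/2" P] \<open>- B \<in> P\<close> \<open>e > 0\<close> l_def by auto
    then have 1: "\<forall>\<^sub>F x in F. l - e/2 < g x"
      unfolding P_def by (auto elim: eventually_mono)
    have "l + e/4 \<notin> P"
      using cSup_upper[OF _ bddP, of "l + e/4"] \<open>e > 0\<close> l_def by auto
    then have 2: "\<forall>\<^sub>F x in F. g x \<le> l + e/2"
      using gap[of "l + e/4" "l + e/2"] \<open>e > 0\<close> unfolding P_def by auto
    show "\<forall>\<^sub>F x in F. dist (g x) l < e"
      using 1 2 by eventually_elim (use \<open>e > 0\<close> in \<open>auto simp: dist_real_def abs_if\<close>)
  qed
  then show ?thesis ..
qed

text \<open>The quantifier over scales is countable, so for continuous \<open>f\<close> the set of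
  such points is a countable intersection of open sets. The quantifier over \<open>h\<close> may
  remain uncountable, since it only forms unions of open sets. This makes nonexistence of a
  derivative measurable, as Fubini's theorem requires.\<close>

definition oscillates :: "('a::real_normed_vector \<Rightarrow> real) \<Rightarrow> 'a \<Rightarrow> real \<Rightarrow> real \<Rightarrow> 'a \<Rightarrow> bool" where
  "oscillates f v p q z \<longleftrightarrow>
     (\<forall>n::nat. \<exists>h. h \<noteq> 0 \<and> \<bar>h\<bar> < inverse (Suc n) \<and> (f (z + h *\<^sub>R v) - f z) / h < p) \<and>
     (\<forall>n::nat. \<exists>h. h \<noteq> 0 \<and> \<bar>h\<bar> < inverse (Suc n) \<and> (f (z + h *\<^sub>R v) - f z) / h > q)"

lemma oscillates_borel [measurable]:
  fixes f :: "'a::euclidean_space \<Rightarrow> real"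
  assumes "continuous_on UNIV f"
  shows "Measurable.pred borel (oscillates f v p q)"
proof -
  \<comment> \<open>For \<open>h = 0\<close> division by zero makes the quotient constantly 0, so
    continuity holds for every \<open>h\<close>.\<close>
  have c: "continuous_on UNIV (\<lambda>z. (f (z + h *\<^sub>R v) - f z) / h)" for h :: real
    by (cases "h = 0") (auto intro!: continuous_intros continuous_on_compose2[OF assms])
  have "open {z. \<exists>h. h \<noteq> 0 \<and> \<bar>h\<bar> < inverse (Suc n) \<and> (f (z + h *\<^sub>R v) - f z) / h < p}" for n :: nat
  proof -
    have "{z. \<exists>h. h \<noteq> 0 \<and> \<bar>h\<bar> < inverse (Suc n) \<and> (f (z + h *\<^sub>R v) - f z) / h < p} =
      (\<Union>h\<in>{h. h \<noteq> 0 \<and> \<bar>h\<bar> < inverse (Suc n)}. {z. (f (z + h *\<^sub>R v) - f z) / h < p})" by auto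
    then show ?thesis
      by (auto intro!: open_UN open_Collect_less c)
  qed
  moreover have "open {z. \<exists>h. h \<noteq> 0 \<and> \<bar>h\<bar> < inverse (Suc n) \<and> (f (z + h *\<^sub>R v) - f z) / h > q}" for n :: nat
  proof -
    have "{z. \<exists>h. h \<noteq> 0 \<and> \<bar>h\<bar> < inverse (Suc n) \<and> (f (z + h *\<^sub>R v) - f z) / h > q} =
      (\<Union>h\<in>{h. h \<noteq> 0 \<and> \<bar>h\<bar> < inverse (Suc n)}. {z. (f (z + h *\<^sub>R v) - f z) / h > q})" by auto
    then show ?thesis
      by (auto intro!: open_UN open_Collect_less c)
  qed
  ultimately have [measurable]:
    "Measurable.pred borel (\<lambda>z. \<exists>h. h \<noteq> 0 \<and> \<bar>h\<bar> < inverse (Suc n) \<and> (f (z + h *\<^sub>R v) - f z) / h < p)"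
    "Measurable.pred borel (\<lambda>z. \<exists>h. h \<noteq> 0 \<and> \<bar>h\<bar> < inverse (Suc n) \<and> (f (z + h *\<^sub>R v) - f z) / h > q)"
    for n :: nat
    by (simp_all add: pred_def borel_open)
  show ?thesis
    unfolding oscillates_def by measurable
qed

lemma lipschitz_quotient_bound:
  fixes f :: "'a::real_normed_vector \<Rightarrow> real"
  assumes "C-lipschitz_on UNIV f"
  shows "\<bar>(f (z + h *\<^sub>R v) - f z) / h\<bar> \<le> C * norm v"
proof (cases "h = 0")
  case False
  have "\<bar>f (z + h *\<^sub>R v) - f z\<bar> \<le> C * norm (h *\<^sub>R v)"
    using lipschitz_onD[OF assms, of "z + h *\<^sub>R v" z] by (simp add: dist_norm)
  then show ?thesis using False by (simp add: field_simps)
qed (use lipschitz_on_nonneg[OF assms] in simp)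

lemma directional_derivative_iff:
  fixes f :: "'a::real_normed_vector \<Rightarrow> real"
  shows "((\<lambda>t. f (z + t *\<^sub>R v)) has_real_derivative D) (at 0) \<longleftrightarrow>
    ((\<lambda>h. (f (z + h *\<^sub>R v) - f z) / h) \<longlongrightarrow> D) (at 0)"
  by (simp add: DERIV_def)

lemma inverse_Suc_less: "d > 0 \<Longrightarrow> \<exists>n::nat. inverse (Suc n) < (d::real)"
  using reals_Archimedean by blast

text \<open>The Lipschitz bound excludes infinite limits, so a derivative can only fail to exist
  through a gap between lower and upper limit, and every gap contains two rationals. The right-hand
  side is a countable conjunction.\<close>

lemma directional_derivative_iff_not_oscillates:
  fixes f :: "'a::real_normed_vector \<Rightarrow> real"
  assumes "C-lipschitz_on UNIV f"
  shows "(\<exists>D. ((\<lambda>t. f (z + t *\<^sub>R v)) has_real_derivative D) (at 0)) \<longleftrightarrow>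
    (\<forall>p\<in>\<rat>. \<forall>q\<in>\<rat>. p < q \<longrightarrow> \<not> oscillates f v p q z)" (is "?L \<longleftrightarrow> ?R")
proof
  define g where "g = (\<lambda>h. (f (z + h *\<^sub>R v) - f z) / h)"
  assume ?L
  then obtain D where D: "(g \<longlongrightarrow> D) (at 0)"
    unfolding directional_derivative_iff g_def by auto
  show ?R
  proof (intro ballI impI notI)
    fix p q assume pq: "p < q" and osc: "oscillates f v p q z"
    show False
    \<comment> \<open>The derivative cannot be at most \<open>p\<close> and at least
      \<open>q\<close> at once; either case contradicts one half of the oscillation.\<close>
    proof (cases "p < D")
      case True
      then have "\<forall>\<^sub>F h in at 0. p < g h" using D by (simp add: order_tendstoD)
      then obtain d where d: "d > 0" "\<And>h. h \<noteq> 0 \<Longrightarrow> \<bar>h\<bar> < d \<Longrightarrow> p < g h"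
        by (auto simp: eventually_at dist_real_def)
      obtain n :: nat where "inverse (Suc n) < d" using inverse_Suc_less[OF d(1)] by blast
      then show False using osc d(2) unfolding oscillates_def g_def
        by (smt (verit, ccfv_threshold))
    next
      case False
      then have "\<forall>\<^sub>F h in at 0. g h < q" using D pq by (simp add: order_tendstoD)
      then obtain d where d: "d > 0" "\<And>h. h \<noteq> 0 \<Longrightarrow> \<bar>h\<bar> < d \<Longrightarrow> g h < q"
        by (auto simp: eventually_at dist_real_def)
      obtain n :: nat where "inverse (Suc n) < d" using inverse_Suc_less[OF d(1)] by blast
      then show False using osc d(2) unfolding oscillates_def g_def
        by (smt (verit, ccfv_threshold))
    qed
  qed
next
  define g where "g = (\<lambda>h. (f (z + h *\<^sub>R v) - f z) / h)"
  assume R: ?R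
  have "\<exists>l. (g \<longlongrightarrow> l) (at 0)"
  proof (rule tendsto_of_no_oscillation)
    show "\<forall>\<^sub>F x in at 0. \<bar>g x\<bar> \<le> C * norm v"
      unfolding g_def using lipschitz_quotient_bound[OF assms] by simp
    fix p q :: real assume "p < q"
    then obtain p' where p': "p' \<in> \<rat>" "p < p'" "p' < q" using Rats_dense_in_real by blast
    then obtain q' where q': "q' \<in> \<rat>" "p' < q'" "q' < q" using Rats_dense_in_real by blast
    have "\<not> oscillates f v p' q' z" using R p' q' by auto
    then consider n :: nat where "\<forall>h. h \<noteq> 0 \<and> \<bar>h\<bar> < inverse (Suc n) \<longrightarrow> p' \<le> g h"
      | n :: nat where "\<forall>h. h \<noteq> 0 \<and> \<bar>h\<bar> < inverse (Suc n) \<longrightarrow> g h \<le> q'"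
      unfolding oscillates_def g_def not_less [symmetric] by blast
    then show "(\<forall>\<^sub>F x in at 0. p \<le> g x) \<or> (\<forall>\<^sub>F x in at 0. g x \<le> q)"
    proof cases
      case (1 n)
      then have "\<forall>\<^sub>F x in at 0. p \<le> g x"
        unfolding eventually_at using p'
        by (intro exI[of _ "inverse (Suc n)"]) (force simp: dist_real_def)
      then show ?thesis ..
    next
      case (2 n)
      then have "\<forall>\<^sub>F x in at 0. g x \<le> q"
        unfolding eventually_at using q'
        by (intro exI[of _ "inverse (Suc n)"]) (force simp: dist_real_def)
      then show ?thesis ..
    qed
  qed simp
  then show ?L unfolding directional_derivative_iff g_def .
qed

section \<open>Lebesgue differentiation on the line\<close>

text \<open>Disjointness turns both sides into sums that are compared ball by ball. The pairs of
  centre and radius are the indexing used with Vitali's covering theorem.\<close>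

lemma emeasure_UN_cball_le:
  fixes M N :: "real measure"
  assumes sets: "sets M = sets borel" "sets N = sets borel" and "countable \<C>"
    and disj: "pairwise (\<lambda>i j. disjnt (cball (fst i) (snd i)) (cball (fst j) (snd j))) \<C>"
    and le: "\<And>a r. (a, r) \<in> \<C> \<Longrightarrow> emeasure M (cball a r) \<le> c * emeasure N (cball a r)"
  shows "emeasure M (\<Union>(a, r)\<in>\<C>. cball a r) \<le> c * emeasure N (\<Union>(a, r)\<in>\<C>. cball a r)"
proof -
  have d: "disjoint_family_on (\<lambda>(a, r). cball a r) \<C>"
    using disj unfolding disjoint_family_on_def pairwise_def disjnt_def case_prod_beta .
  have "emeasure M (\<Union>(a, r)\<in>\<C>. cball a r) = (\<integral>\<^sup>+i. emeasure M (case i of (a, r) \<Rightarrow> cball a r) \<partial>count_space \<C>)"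
    by (rule emeasure_UN_countable) (use assms d in \<open>auto split: prod.splits\<close>)
  also have "\<dots> \<le> (\<integral>\<^sup>+i. c * emeasure N (case i of (a, r) \<Rightarrow> cball a r) \<partial>count_space \<C>)"
    by (rule nn_integral_mono) (use le in auto)
  also have "\<dots> = c * (\<integral>\<^sup>+i. emeasure N (case i of (a, r) \<Rightarrow> cball a r) \<partial>count_space \<C>)"
    by (rule nn_integral_cmult) auto
  also have "(\<integral>\<^sup>+i. emeasure N (case i of (a, r) \<Rightarrow> cball a r) \<partial>count_space \<C>) = emeasure N (\<Union>(a, r)\<in>\<C>. cball a r)"
    by (rule emeasure_UN_countable [symmetric]) (use assms d in \<open>auto split: prod.splits\<close>)
  finally show ?thesis .
qed

text \<open>Difference quotients provide intervals with \<open>x\<close> as an endpoint, not as the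
  centre. Vitali's theorem only asks that \<open>x\<close> belong to arbitrarily small closed balls
  of the family, so the interval between \<open>x\<close> and \<open>x + h\<close> enters as the
  ball of radius \<open>\<bar>h\<bar> / 2\<close> around \<open>x + h / 2\<close>.\<close>

lemma Vitali_covering_intervals:
  fixes E :: "real set"
  assumes "open G" "E \<subseteq> G"
    and fine: "\<And>x d. x \<in> E \<Longrightarrow> 0 < d \<Longrightarrow> \<exists>h. h \<noteq> 0 \<and> \<bar>h\<bar> < d \<and> Q (min x (x + h)) (max x (x + h))"
  obtains \<C> where "countable \<C>" "\<And>a r. (a, r) \<in> \<C> \<Longrightarrow> 0 < r \<and> cball a r \<subseteq> G \<and> Q (a - r) (a + r)"
    "pairwise (\<lambda>i j. disjnt (cball (fst i) (snd i)) (cball (fst j) (snd j))) \<C>"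
    "negligible (E - (\<Union>(a, r)\<in>\<C>. cball a r))"
proof -
  define K where "K = {(a, r). 0 < r \<and> cball a r \<subseteq> G \<and> Q (a - r) (a + r)}"
  have 1: "\<exists>i. i \<in> K \<and> x \<in> cball (fst i) (snd i) \<and> snd i < d" if x: "x \<in> E" and "0 < d" for x d
  proof -
    obtain e where e: "e > 0" "ball x e \<subseteq> G" using assms(1,2) x by (metis open_contains_ball subsetD)
    obtain h where h: "h \<noteq> 0" "\<bar>h\<bar> < min d e" "Q (min x (x + h)) (max x (x + h))"
      using fine[OF x, of "min d e"] e \<open>0 < d\<close> by auto
    have "x + h / 2 - \<bar>h\<bar> / 2 = min x (x + h)" "x + h / 2 + \<bar>h\<bar> / 2 = max x (x + h)" by auto
    moreover have "cball (x + h/2) (\<bar>h\<bar>/2) \<subseteq> ball x e"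
      using h by (auto simp: dist_real_def abs_if split: if_splits)
    ultimately have "(x + h / 2, \<bar>h\<bar> / 2) \<in> K"
      unfolding K_def using h e by auto
    then show ?thesis using h \<open>0 < d\<close>
      by (intro exI[of _ "(x + h / 2, \<bar>h\<bar> / 2)"]) (auto simp: dist_real_def)
  qed
  have 0: "0 < snd i" if "i \<in> K" for i
    using that by (auto simp: K_def)
  obtain \<C> where "countable \<C>" "\<C> \<subseteq> K"
     "pairwise (\<lambda>i j. disjnt (cball (fst i) (snd i)) (cball (fst j) (snd j))) \<C>"
     "negligible (E - (\<Union>i \<in> \<C>. cball (fst i) (snd i)))"
    by (rule Vitali_covering_theorem_cballs[of K snd E fst]) ((rule 0 1 that; assumption)+)
  then show ?thesis
    by (intro that[of \<C>]) (auto simp: K_def case_prod_beta subset_iff)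
qed

lemma emeasure_le_if_negligible_Diff:
  fixes E U :: "'a::euclidean_space set"
  assumes "E \<in> sets borel" "U \<in> sets borel" "negligible (E - U)"
  shows "emeasure lborel E \<le> emeasure lborel U"
proof -
  have "E - U \<in> null_sets lborel"
    using assms by (auto simp: negligible_iff_null_sets null_sets_completion_iff)
  then have "emeasure lborel E \<le> emeasure lborel (U \<union> (E - U))"
    using assms by (intro emeasure_mono) auto
  also have "\<dots> = emeasure lborel U"
    using assms \<open>E - U \<in> null_sets lborel\<close> by (intro emeasure_Un_null_set) auto
  finally show ?thesis .
qed

text \<open>Two nested covers contradict each other. Almost all of \<open>E\<close> is covered by
  disjoint intervals of average slope at most \<open>p\<close> inside an open set barely larger than
  \<open>E\<close>, and then, inside these, by disjoint intervals of average slope at least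
  \<open>q\<close>. The Stieltjes measure of the inner cover is at least \<open>q * s\<close>, that
  of the outer one at most \<open>p * (s + e)\<close>.\<close>

lemma emeasure_oscillation_set_eq_0:
  fixes f :: "real \<Rightarrow> real"
  assumes mono: "mono f" and cont: "continuous_on UNIV f" and pq: "0 < p" "p < q"
    and E: "E \<in> sets borel" "bounded E" and osc: "\<And>x. x \<in> E \<Longrightarrow> oscillates f 1 p q x"
  shows "emeasure lborel E = 0"
proof (rule ccontr)
  assume ne: "emeasure lborel E \<noteq> 0"
  define s where "s = measure lborel E"
  have fin: "emeasure lborel E < \<infinity>"
    using E(2) by (rule emeasure_bounded_finite)
  then have Es: "emeasure lborel E = ennreal s"
    unfolding s_def by (simp add: emeasure_eq_ennreal_measure top.not_eq_extremum)
  have "s > 0" using ne Es by (metis ennreal_neg not_le ennreal_0 order.order_iff_strict)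
  define M where "M = interval_measure f"
  have sM: "sets M = sets borel" unfolding M_def by simp
  have M: "emeasure M (cball a r) = ennreal (f (a + r) - f (a - r))" if "0 < r" for a r
    unfolding M_def cball_eq_atLeastAtMost
    by (rule emeasure_interval_measure_Icc) (use mono cont that in \<open>auto simp: mono_def\<close>)
  have L: "emeasure lborel (cball a r) = ennreal (2 * r)" if "0 < r" for a r :: real
    unfolding cball_eq_atLeastAtMost using that by simp
  \<comment> \<open>With this choice \<open>p * (s + e)\<close> is the midpoint of
    \<open>p * s\<close> and \<open>q * s\<close>.\<close>
  define e where "e = s * (q / p - 1) / 2"
  have "e > 0" unfolding e_def using \<open>s > 0\<close> pq by (simp add: field_simps)
  have "p * (s + e) < q * s"
  proof -
    have "p * e = s * (q - p) / 2" unfolding e_def using pq by (simp add: field_simps)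
    moreover have "s * (q - p) > 0" using \<open>s > 0\<close> pq by simp
    ultimately show ?thesis by (simp add: algebra_simps)
  qed
  obtain G where G: "open G" "E \<subseteq> G" "emeasure lborel (G - E) < e"
    using outer_regular_lborel[OF E(1) \<open>e > 0\<close>] .
  have "emeasure lborel G = emeasure lborel (E \<union> (G - E))"
    using G(2) by (simp add: Un_absorb1)
  also have "\<dots> \<le> emeasure lborel E + emeasure lborel (G - E)"
    using G(1) E(1) by (intro emeasure_subadditive) auto
  also have "\<dots> \<le> ennreal (s + e)"
    using G(3) \<open>s > 0\<close> \<open>e > 0\<close> by (simp add: Es ennreal_plus add_left_mono order.strict_implies_order)
  finally have lG: "emeasure lborel G \<le> ennreal (s + e)" .
  have small: "\<exists>h. h \<noteq> 0 \<and> \<bar>h\<bar> < d \<and> f (max x (x + h)) - f (min x (x + h)) \<le> p * (max x (x + h) - min x (x + h))"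
    if "x \<in> E" "0 < d" for x d
  proof -
    obtain n :: nat where n: "inverse (Suc n) < d" using inverse_Suc_less[OF \<open>0 < d\<close>] by blast
    obtain h where h: "h \<noteq> 0" "\<bar>h\<bar> < inverse (Suc n)" "(f (x + h) - f x) / h < p"
      using osc[OF \<open>x \<in> E\<close>] unfolding oscillates_def real_scaleR_def mult_1_right by blast
    have "\<bar>h\<bar> < d" using h n by linarith
    then show ?thesis
      using h(1,3) by (intro exI[of _ h], cases "h > 0") (auto simp: max_def min_def field_simps)
  qed
  have large: "\<exists>h. h \<noteq> 0 \<and> \<bar>h\<bar> < d \<and> f (max x (x + h)) - f (min x (x + h)) \<ge> q * (max x (x + h) - min x (x + h))"
    if "x \<in> E" "0 < d" for x d
  proof -
    obtain n :: nat where n: "inverse (Suc n) < d" using inverse_Suc_less[OF \<open>0 < d\<close>] by blast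
    obtain h where h: "h \<noteq> 0" "\<bar>h\<bar> < inverse (Suc n)" "(f (x + h) - f x) / h > q"
      using osc[OF \<open>x \<in> E\<close>] unfolding oscillates_def real_scaleR_def mult_1_right by blast
    have "\<bar>h\<bar> < d" using h n by linarith
    then show ?thesis
      using h(1,3) by (intro exI[of _ h], cases "h > 0") (auto simp: max_def min_def field_simps)
  qed
  obtain \<C> where C: "countable \<C>" "\<And>a r. (a, r) \<in> \<C> \<Longrightarrow> 0 < r \<and> cball a r \<subseteq> G \<and> f (a + r) - f (a - r) \<le> p * ((a + r) - (a - r))"
    "pairwise (\<lambda>i j. disjnt (cball (fst i) (snd i)) (cball (fst j) (snd j))) \<C>"
    "negligible (E - (\<Union>(a, r)\<in>\<C>. cball a r))"
    by (rule Vitali_covering_intervals[OF G(1,2), where Q="\<lambda>x y. f y - f x \<le> p * (y - x)"]) ((rule small that; assumption)+)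
  \<comment> \<open>The second cover has to live inside an open set, so the closed intervals are
    replaced by their interiors; the endpoints given up are countably many.\<close>
  define W where "W = (\<Union>(a, r)\<in>\<C>. ball a r)"
  have "open W" unfolding W_def by auto
  have Ub: "(\<Union>(a, r)\<in>\<C>. cball a r) \<in> sets borel"
    using C(1) by (intro sets.countable_UN') auto
  have "negligible (\<Union>(a, r)\<in>\<C>. sphere a r)"
    by (intro negligible_countable_Union) (use C(1) in \<open>auto intro!: negligible_sphere\<close>)
  then have "negligible ((E - (\<Union>(a, r)\<in>\<C>. cball a r)) \<union> (\<Union>(a, r)\<in>\<C>. sphere a r))"
    using C(4) by (intro negligible_Un)
  moreover have "E - W \<subseteq> ((E - (\<Union>(a, r)\<in>\<C>. cball a r)) \<union> (\<Union>(a, r)\<in>\<C>. sphere a r))"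
    unfolding W_def by (fastforce simp: split: prod.splits)
  ultimately have nEW: "negligible (E - W)" using negligible_subset by blast
  obtain \<D> where D: "countable \<D>" "\<And>a r. (a, r) \<in> \<D> \<Longrightarrow> 0 < r \<and> cball a r \<subseteq> W \<and> f (a + r) - f (a - r) \<ge> q * ((a + r) - (a - r))"
    "pairwise (\<lambda>i j. disjnt (cball (fst i) (snd i)) (cball (fst j) (snd j))) \<D>"
    "negligible (E \<inter> W - (\<Union>(a, r)\<in>\<D>. cball a r))"
    by (rule Vitali_covering_intervals[OF \<open>open W\<close> Int_lower2, where Q="\<lambda>x y. f y - f x \<ge> q * (y - x)"]) ((rule large[OF IntD1] that; assumption)+)
  have Vb: "(\<Union>(a, r)\<in>\<D>. cball a r) \<in> sets borel"
    using D(1) by (intro sets.countable_UN') auto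
  have "ennreal s \<le> emeasure lborel (\<Union>(a, r)\<in>\<D>. cball a r)"
  proof -
    have "negligible (E - (\<Union>(a, r)\<in>\<D>. cball a r))"
      by (rule negligible_subset[OF negligible_Un[OF nEW D(4)]]) auto
    then show ?thesis unfolding Es[symmetric] using E(1) Vb by (intro emeasure_le_if_negligible_Diff)
  qed
  also have "\<dots> \<le> ennreal (1 / q) * emeasure M (\<Union>(a, r)\<in>\<D>. cball a r)"
  proof (rule emeasure_UN_cball_le[OF _ sM D(1,3)])
    fix a r assume ar: "(a, r) \<in> \<D>"
    then have "2 * r \<le> 1 / q * (f (a + r) - f (a - r))"
      using D(2)[OF ar] pq by (simp add: field_simps)
    then show "emeasure lborel (cball a r) \<le> ennreal (1 / q) * emeasure M (cball a r)"
      using D(2)[OF ar] pq by (simp add: L M ennreal_mult'[symmetric] ennreal_leI)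
  qed simp
  also have "\<dots> \<le> ennreal (1 / q) * emeasure M (\<Union>(a, r)\<in>\<C>. cball a r)"
  proof (intro mult_left_mono emeasure_mono)
    show "(\<Union>(a, r)\<in>\<D>. cball a r) \<subseteq> (\<Union>(a, r)\<in>\<C>. cball a r)"
    proof -
      have "cball a r \<subseteq> W" if "(a, r) \<in> \<D>" for a r using D(2)[OF that] by simp
      then have "(\<Union>(a, r)\<in>\<D>. cball a r) \<subseteq> W" by blast
      also have "W \<subseteq> (\<Union>(a, r)\<in>\<C>. cball a r)"
        unfolding W_def by (rule UN_mono) auto
      finally show ?thesis .
    qed
  qed (use Ub sM in auto)
  also have "\<dots> \<le> ennreal (1 / q) * (ennreal p * emeasure lborel (\<Union>(a, r)\<in>\<C>. cball a r))"
  proof (intro mult_left_mono emeasure_UN_cball_le[OF sM _ C(1,3)])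
    fix a r assume ar: "(a, r) \<in> \<C>"
    then have "f (a + r) - f (a - r) \<le> p * (2 * r)" using C(2) by auto
    then show "emeasure M (cball a r) \<le> ennreal p * emeasure lborel (cball a r)"
      using C(2)[OF ar] pq by (simp add: L M ennreal_mult'[symmetric] ennreal_leI)
  qed auto
  also have "\<dots> \<le> ennreal (1 / q) * (ennreal p * emeasure lborel G)"
    by (intro mult_left_mono emeasure_mono) (use C(2) G(1) in auto)
  also have "\<dots> \<le> ennreal (1 / q) * (ennreal p * ennreal (s + e))"
    by (intro mult_left_mono lG) auto
  also have "\<dots> = ennreal (1 / q * (p * (s + e)))"
    using pq \<open>s > 0\<close> \<open>e > 0\<close> by (simp add: ennreal_mult'[symmetric] del: ennreal_plus)
  finally have "s \<le> 1 / q * (p * (s + e))"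
    using pq \<open>s > 0\<close> \<open>e > 0\<close> by (subst (asm) ennreal_le_iff) auto
  then show False
    using \<open>p * (s + e) < q * s\<close> pq by (simp add: field_simps)
qed

text \<open>Adding a large multiple of the identity makes all difference quotients positive.\<close>

lemma lipschitz_AE_derivative_real:
  fixes f :: "real \<Rightarrow> real"
  assumes lip: "C-lipschitz_on UNIV f"
  shows "AE x in lborel. \<exists>D. ((\<lambda>t. f (x + t *\<^sub>R 1)) has_real_derivative D) (at 0)"
proof -
  define g where "g = (\<lambda>x. f x + (C + 1) * x)"
  have C: "C \<ge> 0" using lip by (rule lipschitz_on_nonneg)
  have fb: "\<bar>f x - f y\<bar> \<le> C * \<bar>x - y\<bar>" for x y
    using lipschitz_onD[OF lip, of x y] by (simp add: dist_real_def)
  have gd: "g y - g x \<ge> y - x" if "x \<le> y" for x y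
    using fb[of x y] that unfolding g_def by (auto simp: algebra_simps abs_if split: if_splits)
  have lipg: "(C + (C + 1) * 1)-lipschitz_on UNIV g"
    unfolding g_def using C
    by (intro lipschitz_on_add lip lipschitz_intros) auto
  have contg: "continuous_on UNIV g"
    using lipg by (rule lipschitz_on_continuous_on)
  have "mono g" using gd by (intro monoI) (smt (verit))
  have gquot: "(g (x + h) - g x) / h \<ge> 1" if "h \<noteq> 0" for x h
    using gd[of x "x + h"] gd[of "x + h" x] that by (cases "h > 0") (auto simp: field_simps)
  have "AE x in lborel. \<not> oscillates g 1 p q x" if "p < q" for p q
  proof (cases "p > 0")
    case False
    have "\<not> oscillates g 1 p q x" for x
    proof
      assume "oscillates g 1 p q x"
      then obtain h where "h \<noteq> 0" "(g (x + h) - g x) / h < p"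
        unfolding oscillates_def real_scaleR_def mult_1_right by blast
      then show False using gquot[of h x] False by linarith
    qed
    then show ?thesis by simp
  next
    case True
    \<comment> \<open>The covering argument needs sets of finite measure, hence the exhaustion by
      bounded pieces.\<close>
    define N where "N = (\<lambda>k. {x. oscillates g 1 p q x} \<inter> ball 0 (real k))"
    have b: "{x. oscillates g 1 p q x} \<in> sets borel"
      using oscillates_borel[OF contg, of 1 p q] by (simp add: pred_def)
    have "N k \<in> null_sets lborel" for k
    proof -
      have "N k \<in> sets borel" unfolding N_def using b by auto
      moreover have "emeasure lborel (N k) = 0"
        by (rule emeasure_oscillation_set_eq_0[OF \<open>mono g\<close> contg True \<open>p < q\<close> \<open>N k \<in> sets borel\<close>])
          (auto simp: N_def)
      ultimately show ?thesis by (auto simp: null_sets_def)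
    qed
    then have "(\<Union>k. N k) \<in> null_sets lborel" by (intro null_sets_UN)
    moreover have "{x. oscillates g 1 p q x} \<subseteq> (\<Union>k. N k)"
      unfolding N_def by (auto simp: reals_Archimedean2)
    ultimately show ?thesis
      by (auto simp: eventually_ae_filter)
  qed
  then have "AE x in lborel. \<forall>p\<in>\<rat>. \<forall>q\<in>\<rat>. p < q \<longrightarrow> \<not> oscillates g 1 p q x"
    by (auto simp: AE_ball_countable countable_rat)
  then show ?thesis
  proof (rule AE_mp, intro AE_I2 impI)
    fix x assume "\<forall>p\<in>\<rat>. \<forall>q\<in>\<rat>. p < q \<longrightarrow> \<not> oscillates g 1 p q x"
    then obtain D where D: "((\<lambda>t. g (x + t *\<^sub>R 1)) has_real_derivative D) (at 0)"
      using directional_derivative_iff_not_oscillates[OF lipg, of x 1] by auto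
    have "((\<lambda>t. g (x + t *\<^sub>R 1) - (C + 1) * (x + t)) has_real_derivative (D - (C + 1))) (at 0)"
      by (rule derivative_eq_intros D refl | simp)+
    then show "\<exists>D. ((\<lambda>t. f (x + t *\<^sub>R 1)) has_real_derivative D) (at 0)"
      unfolding g_def by auto
  qed
qed

section \<open>Rademacher's theorem\<close>

text \<open>Almost every point of almost every line in direction \<open>v\<close> is good; swapping the quantifiers, some
  translate of the good set has full measure.\<close>

lemma lipschitz_AE_directional_derivative:
  fixes f :: "'a::euclidean_space \<Rightarrow> real"
  assumes lip: "C-lipschitz_on UNIV f"
  shows "AE z in lborel. \<exists>D. ((\<lambda>t. f (z + t *\<^sub>R v)) has_real_derivative D) (at 0)"
proof -
  \<comment> \<open>Differentiability is replaced by this equivalent condition because it is visibly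
    Borel, which the exchange of the two almost everywhere quantifiers needs.\<close>
  let ?P = "\<lambda>z. \<forall>p\<in>\<rat>. \<forall>q\<in>\<rat>. p < q \<longrightarrow> \<not> oscillates f v p q z"
  have [measurable]: "Measurable.pred borel (oscillates f v p q)" for p q
    using lip by (intro oscillates_borel lipschitz_on_continuous_on)
  have line: "AE t in lborel. ?P (z + t *\<^sub>R v)" for z
  proof -
    have "(C * norm v)-lipschitz_on UNIV (\<lambda>t. f (z + t *\<^sub>R v))"
    proof (rule lipschitz_onI)
      fix s t :: real
      have "dist (f (z + s *\<^sub>R v)) (f (z + t *\<^sub>R v)) \<le> C * dist (z + s *\<^sub>R v) (z + t *\<^sub>R v)"
        by (rule lipschitz_onD[OF lip]) auto
      also have "dist (z + s *\<^sub>R v) (z + t *\<^sub>R v) = dist s t * norm v"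
        by (simp add: dist_norm scaleR_left_diff_distrib[symmetric])
      finally show "dist (f (z + s *\<^sub>R v)) (f (z + t *\<^sub>R v)) \<le> C * norm v * dist s t"
        by (simp add: mult_ac)
    qed (use lipschitz_on_nonneg[OF lip] in simp)
    then have "AE t in lborel. \<exists>D. ((\<lambda>s. f (z + (t + s *\<^sub>R 1) *\<^sub>R v)) has_real_derivative D) (at 0)"
      by (rule lipschitz_AE_derivative_real)
    then show ?thesis
      by (simp add: directional_derivative_iff_not_oscillates[OF lip, symmetric] scaleR_left_distrib add.assoc)
  qed
  have "AE z in lborel. AE t in lborel. ?P (z + t *\<^sub>R v)"
    using line by simp
  moreover have "{x \<in> space (lborel \<Otimes>\<^sub>M lborel). ?P (fst x + snd x *\<^sub>R v)} \<in> sets (lborel \<Otimes>\<^sub>M lborel)"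
    by (measurable; simp add: countable_rat)
  ultimately have "AE t in lborel. AE z in lborel. ?P (z + (t::real) *\<^sub>R v)"
    by (subst (asm) lborel_pair.AE_commute) auto
  then obtain t :: real where "AE z in lborel. ?P (z + t *\<^sub>R v)"
    using eventually_happens'[of "ae_filter (lborel :: real measure)"] by (auto simp: ae_filter_eq_bot_iff)
  then have "AE z in lborel. ?P (z + (- (t *\<^sub>R v)) + t *\<^sub>R v)"
    by (rule AE_lborel_translation)
  then show ?thesis
    by (simp add: directional_derivative_iff_not_oscillates[OF lip])
qed

section \<open>Additivity of the directional derivative\<close>

lemma AE_eq_0_if_box_integrals_0:
  fixes k :: "'a::euclidean_space \<Rightarrow> real"
  assumes [measurable]: "k \<in> borel_measurable borel" and bdd: "AE z in lborel. \<bar>k z\<bar> \<le> B" "0 \<le> B"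
    and zero: "\<And>l u. (\<integral>z. indicator (box l u) z * k z \<partial>lborel) = 0"
  shows "AE z in lborel. k z = 0"
proof -
  \<comment> \<open>Taking \<open>c\<close> above \<open>B\<close> makes \<open>1 + k z / c\<close>
    nonnegative almost everywhere, hence usable as a density; the added 1 keeps \<open>c\<close>
    positive when \<open>B\<close> is 0.\<close>
  define c where "c = B + 1"
  have c: "c > 0" using bdd(2) unfolding c_def by simp
  have pos: "AE z in lborel. 0 \<le> 1 + k z / c"
    using bdd(1) by eventually_elim (use c in \<open>simp add: c_def field_simps\<close>)
  let ?M = "density lborel (\<lambda>z. ennreal (1 + k z / c))"
  \<comment> \<open>Lebesgue measure is determined by its values on boxes, and there
    \<open>k\<close> contributes nothing. Uniqueness of densities then forces
    \<open>1 + k z / c\<close> to be 1 almost everywhere.\<close>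
  have "lborel = ?M"
  proof (rule lborel_eqI)
    fix l u :: 'a assume lu: "\<And>b. b \<in> Basis \<Longrightarrow> l \<bullet> b \<le> u \<bullet> b"
    let ?A = "box l u"
    have iA: "integrable lborel (indicator ?A :: 'a \<Rightarrow> real)"
      by (rule integrable_real_indicator) (auto simp: emeasure_lborel_box_eq)
    have ik: "integrable lborel (\<lambda>z. indicator ?A z * k z)"
      by (rule Bochner_Integration.integrable_bound[OF integrable_mult_left[OF iA, of B]])
        (use bdd in \<open>auto simp: indicator_def abs_mult elim: eventually_mono\<close>)
    have eq: "indicator ?A z * (1 + k z / c) = indicator ?A z + (indicator ?A z * k z) / c" for z
      by (simp add: field_simps)
    have i: "integrable lborel (\<lambda>z. indicator ?A z * (1 + k z / c))"
      unfolding eq using iA ik by (intro Bochner_Integration.integrable_add integrable_divide_zero) auto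
    have "emeasure ?M ?A = (\<integral>\<^sup>+z. ennreal (1 + k z / c) * indicator ?A z \<partial>lborel)"
      by (rule emeasure_density) auto
    also have "\<dots> = (\<integral>\<^sup>+z. ennreal (indicator ?A z * (1 + k z / c)) \<partial>lborel)"
      by (rule nn_integral_cong) (auto simp: indicator_def)
    also have "\<dots> = ennreal (\<integral>z. indicator ?A z * (1 + k z / c) \<partial>lborel)"
      using i by (rule nn_integral_eq_integral) (use pos in \<open>eventually_elim, simp\<close>)
    also have "(\<integral>z. indicator ?A z * (1 + k z / c) \<partial>lborel) = measure lborel ?A"
      unfolding eq using iA ik by (simp add: zero)
    also have "ennreal (measure lborel ?A) = emeasure lborel ?A"
      using emeasure_lborel_box_finite[of l u] by (simp add: emeasure_eq_ennreal_measure top.not_eq_extremum)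
    also have "\<dots> = (\<Prod>b\<in>Basis. (u - l) \<bullet> b)"
      using lu by (simp add: emeasure_lborel_box)
    finally show "emeasure ?M ?A = (\<Prod>b\<in>Basis. (u - l) \<bullet> b)" .
  qed simp
  then have "density lborel (\<lambda>_. 1) = ?M" by (simp add: density_1)
  then have "AE z in lborel. 1 = ennreal (1 + k z / c)"
    by (intro sigma_finite_measure.density_unique[OF sigma_finite_lborel]) auto
  then show ?thesis
  proof (rule AE_mp, intro AE_I2 impI)
    fix z assume "1 = ennreal (1 + k z / c)"
    then have "1 = 1 + k z / c" by (metis ennreal_eq_1)
    then show "k z = 0" using c by simp
  qed
qed

text \<open>The quotient along \<open>v + w\<close> at \<open>z\<close> is the quotient along
  \<open>v\<close> at \<open>z\<close> plus the quotient along \<open>w\<close> at the moving point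
  \<open>z + s n *\<^sub>R v\<close>, whose pointwise limit is out of control. Under an integral
  over a box, a translation moves the shift from the quotient to the indicator of the box, and
  dominated convergence applies to every term.\<close>

lemma lipschitz_directional_derivative_add:
  fixes f :: "'a::euclidean_space \<Rightarrow> real"
  assumes lip: "C-lipschitz_on UNIV f"
  shows "AE z in lborel. \<forall>a b. ((\<lambda>t. f (z + t *\<^sub>R v)) has_real_derivative a) (at 0) \<longrightarrow>
    ((\<lambda>t. f (z + t *\<^sub>R w)) has_real_derivative b) (at 0) \<longrightarrow>
    ((\<lambda>t. f (z + t *\<^sub>R (v + w))) has_real_derivative (a + b)) (at 0)"
proof -
  have cont: "continuous_on UNIV f" using lip by (rule lipschitz_on_continuous_on)
  have [measurable]: "f \<in> borel_measurable borel"
    using cont by (rule borel_measurable_continuous_onI)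
  have C: "C \<ge> 0" using lip by (rule lipschitz_on_nonneg)
  define s where "s = (\<lambda>n::nat. inverse (real (Suc n)))"
  have s: "s n > 0" "s n \<le> 1" for n unfolding s_def by (auto simp: field_simps)
  have s0: "filterlim s (at 0) sequentially"
    unfolding filterlim_at s_def using LIMSEQ_inverse_real_of_nat by auto
  define q where "q = (\<lambda>u n z. (f (z + s n *\<^sub>R u) - f z) / s n)"
  \<comment> \<open>A limit along one fixed sequence gives a total Borel function that equals the
    derivative wherever the derivative exists.\<close>
  define g where "g = (\<lambda>u z. lim (\<lambda>n. q u n z))"
  have qm[measurable]: "q u n \<in> borel_measurable borel" for u n unfolding q_def by measurable
  have gm[measurable]: "g u \<in> borel_measurable borel" for u unfolding g_def by measurable
  have qb: "\<bar>q u n z\<bar> \<le> C * norm u" for u n z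
    unfolding q_def by (rule lipschitz_quotient_bound[OF lip])
  have DDq: "(\<lambda>n. q u n z) \<longlonglongrightarrow> D" if "((\<lambda>t. f (z + t *\<^sub>R u)) has_real_derivative D) (at 0)" for u z D
    using that s0 unfolding directional_derivative_iff q_def by (rule filterlim_compose)
  then have DDg: "g u z = D" if "((\<lambda>t. f (z + t *\<^sub>R u)) has_real_derivative D) (at 0)" for u z D
    unfolding g_def using that by (blast intro: limI)
  have gq: "AE z in lborel. (\<lambda>n. q u n z) \<longlonglongrightarrow> g u z" for u
    using lipschitz_AE_directional_derivative[OF lip, of u]
    by eventually_elim (use DDq DDg in blast)
  have gb: "AE z in lborel. \<bar>g u z\<bar> \<le> C * norm u" for u
    using gq[of u]
  proof eventually_elim
    case (elim z)
    then have "(\<lambda>n. \<bar>q u n z\<bar>) \<longlonglongrightarrow> \<bar>g u z\<bar>" by (rule tendsto_rabs)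
    then show ?case using qb by (intro LIMSEQ_le_const2) auto
  qed
  have "AE z in lborel. g (v + w) z - g v z - g w z = 0"
  proof (rule AE_eq_0_if_box_integrals_0)
    show "AE z in lborel. \<bar>g (v + w) z - g v z - g w z\<bar> \<le> C * norm (v + w) + C * norm v + C * norm w"
      using gb[of "v + w"] gb[of v] gb[of w] by eventually_elim linarith
    fix l u :: 'a
    let ?A = "box l u"
    let ?I = "indicator ?A :: 'a \<Rightarrow> real"
    have iA: "integrable lborel ?I"
      by (rule integrable_real_indicator) (auto simp: emeasure_lborel_box_eq)
    have bound: "AE z in lborel. norm (?I z * q y n z) \<le> C * norm y * ?I z" for y n
      using qb by (auto simp: indicator_def)
    have iw: "integrable lborel (\<lambda>z. C * norm y * ?I z)" for y :: 'a
      using iA by (rule integrable_mult_right)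
    have lim: "AE z in lborel. (\<lambda>n. ?I z * q y n z) \<longlonglongrightarrow> ?I z * g y z" for y
      using gq[of y] by eventually_elim (rule tendsto_mult_left)
    note dom1 = integral_dominated_convergence[OF _ _ iw lim bound, simplified]
    note int_g = integrable_dominated_convergence[OF _ _ iw lim bound, simplified]
    note int_q = integrable_dominated_convergence2[OF _ _ iw lim bound, simplified]
    obtain R where R: "\<forall>z\<in>?A. norm z \<le> R" using bounded_box[of l u] unfolding bounded_iff by blast
    \<comment> \<open>Since \<open>s n\<close> is at most 1, enlarging the ball by
      \<open>norm v\<close> captures all translates of the box, so one function dominates for every
      \<open>n\<close>.\<close>
    let ?J = "indicator (cball 0 (R + norm v)) :: 'a \<Rightarrow> real"
    have iw2: "integrable lborel (\<lambda>z. C * norm w * ?J z)"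
      by (intro integrable_mult_right integrable_real_indicator emeasure_bounded_finite) auto
    have bound2: "AE z in lborel. norm (?I (z - s n *\<^sub>R v) * q w n z) \<le> C * norm w * ?J z" for n
    proof (intro AE_I2)
      fix z
      show "norm (?I (z - s n *\<^sub>R v) * q w n z) \<le> C * norm w * ?J z"
      proof (cases "z - s n *\<^sub>R v \<in> ?A")
        case True
        then have "norm (z - s n *\<^sub>R v) \<le> R" using R by auto
        moreover have "norm (s n *\<^sub>R v) \<le> norm v" using s[of n] by (simp add: mult_left_le_one_le)
        ultimately have "norm z \<le> R + norm v"
          using norm_triangle_sub[of z "s n *\<^sub>R v"] by linarith
        then show ?thesis using True qb by (simp add: indicator_def)
      qed (use C in simp)
    qed
    \<comment> \<open>The translated indicators converge at every point off the frontier of the box,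
      and the frontier of a convex set is null.\<close>
    have "negligible (frontier ?A)" by (intro negligible_convex_frontier convex_box)
    then have "frontier ?A \<in> null_sets lborel"
      by (auto simp: negligible_iff_null_sets null_sets_completion_iff)
    then have "AE z in lborel. z \<notin> frontier ?A" by (rule AE_not_in)
    then have lim2: "AE z in lborel. (\<lambda>n. ?I (z - s n *\<^sub>R v) * q w n z) \<longlonglongrightarrow> ?I z * g w z"
      using gq[of w]
    proof eventually_elim
      case (elim z)
      have "s \<longlonglongrightarrow> 0" using s0 by (simp add: filterlim_at)
      then have "(\<lambda>n. z - s n *\<^sub>R v) \<longlonglongrightarrow> z - 0 *\<^sub>R v" by (intro tendsto_intros)
      moreover have "isCont ?I z"
        using elim(1) by (simp add: isCont_indicator)
      ultimately have "(\<lambda>n. ?I (z - s n *\<^sub>R v)) \<longlonglongrightarrow> ?I z"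
        by (metis isCont_tendsto_compose scaleR_zero_left diff_zero)
      then show ?case using elim(2) by (rule tendsto_mult)
    qed
    note dom2 = integral_dominated_convergence[OF _ _ iw2 lim2 bound2, simplified]
    note int_q2 = integrable_dominated_convergence2[OF _ _ iw2 lim2 bound2, simplified]
    have "(\<integral>z. ?I z * q (v + w) n z \<partial>lborel) =
      (\<integral>z. ?I (z - s n *\<^sub>R v) * q w n z \<partial>lborel) + (\<integral>z. ?I z * q v n z \<partial>lborel)" for n
    proof -
      have "?I z * q (v + w) n z = ?I (z + s n *\<^sub>R v - s n *\<^sub>R v) * q w n (z + s n *\<^sub>R v) + ?I z * q v n z" for z
        unfolding q_def by (simp add: scaleR_right_distrib diff_divide_distrib algebra_simps)
      moreover have "?I z * q w n (z + s n *\<^sub>R v) = ?I z * q (v + w) n z - ?I z * q v n z" for z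
        unfolding q_def by (simp add: scaleR_right_distrib diff_divide_distrib algebra_simps)
      then have "integrable lborel (\<lambda>z. ?I z * q w n (z + s n *\<^sub>R v))"
        using int_q by simp
      ultimately have "(\<integral>z. ?I z * q (v + w) n z \<partial>lborel) =
        (\<integral>z. ?I (z + s n *\<^sub>R v - s n *\<^sub>R v) * q w n (z + s n *\<^sub>R v) \<partial>lborel) + (\<integral>z. ?I z * q v n z \<partial>lborel)"
        using int_q by simp
      then show ?thesis
        using integral_lborel_translation[of "\<lambda>z. ?I (z - s n *\<^sub>R v) * q w n z" "s n *\<^sub>R v"] by simp
    qed
    moreover have "(\<lambda>n. (\<integral>z. ?I (z - s n *\<^sub>R v) * q w n z \<partial>lborel) + (\<integral>z. ?I z * q v n z \<partial>lborel))
      \<longlonglongrightarrow> (\<integral>z. ?I z * g w z \<partial>lborel) + (\<integral>z. ?I z * g v z \<partial>lborel)"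
      by (intro tendsto_add dom1 dom2)
    ultimately have "(\<integral>z. ?I z * g (v + w) z \<partial>lborel) =
      (\<integral>z. ?I z * g w z \<partial>lborel) + (\<integral>z. ?I z * g v z \<partial>lborel)"
      using LIMSEQ_unique[OF dom1[of "v + w"]] by simp
    then show "(\<integral>z. ?I z * (g (v + w) z - g v z - g w z) \<partial>lborel) = 0"
      using int_g by (simp add: right_diff_distrib)
  qed (use C in auto)
  then show ?thesis
    using lipschitz_AE_directional_derivative[OF lip, of "v + w"]
  proof eventually_elim
    case (elim z)
    then obtain D where D: "((\<lambda>t. f (z + t *\<^sub>R (v + w))) has_real_derivative D) (at 0)" by blast
    show ?case
    proof (intro allI impI)
      fix a b
      assume "((\<lambda>t. f (z + t *\<^sub>R v)) has_real_derivative a) (at 0)"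
        and "((\<lambda>t. f (z + t *\<^sub>R w)) has_real_derivative b) (at 0)"
      then have "D = a + b"
        using elim(1) DDg[OF D] DDg[of z v a] DDg[of z w b] by simp
      then show "((\<lambda>t. f (z + t *\<^sub>R (v + w))) has_real_derivative (a + b)) (at 0)"
        using D by simp
    qed
  qed
qed

text \<open>By compactness of the unit sphere, finitely many directions of \<open>D\<close> come
  within \<open>e\<close> of every unit vector. Convergence is uniform over these finitely many, and
  the Lipschitz bound carries it to all other directions.\<close>

lemma has_derivative_if_directional_on_dense:
  fixes f :: "'a::euclidean_space \<Rightarrow> real"
  assumes lip: "C-lipschitz_on UNIV f"
    and dense: "\<And>X::'a set. open X \<Longrightarrow> X \<noteq> {} \<Longrightarrow> \<exists>d\<in>D. d \<in> X"
    and dir: "\<And>v. v \<in> D \<Longrightarrow> ((\<lambda>t. f (z + t *\<^sub>R v)) has_real_derivative (a \<bullet> v)) (at 0)"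
  shows "(f has_derivative (\<lambda>v. a \<bullet> v)) (at z)"
proof -
  have C: "C \<ge> 0" using lip by (rule lipschitz_on_nonneg)
  \<comment> \<open>Three errors add up, each proportional to \<open>e * t\<close>: changing the
    direction in \<open>f\<close> costs \<open>C\<close>, changing it in the linear part costs
    \<open>norm a\<close>, and the quotient along the chosen direction costs 1.\<close>
  define B where "B = C + norm a + 1"
  have "B > 0" using C unfolding B_def by (simp add: add_nonneg_pos)
  show ?thesis
    unfolding has_derivative_at_alt
  proof (intro conjI allI impI)
    show "bounded_linear (\<lambda>v. a \<bullet> v)" by (rule bounded_linear_inner_right)
    fix e' :: real assume "e' > 0"
    define e where "e = e' / B"
    have "e > 0" using \<open>e' > 0\<close> \<open>B > 0\<close> by (simp add: e_def)
    have "sphere 0 1 \<subseteq> (\<Union>v\<in>D. ball v e)"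
    proof
      fix u :: 'a
      obtain v where "v \<in> D" "v \<in> ball u e" using dense[of "ball u e"] \<open>e > 0\<close> by auto
      then show "u \<in> (\<Union>v\<in>D. ball v e)" by (auto simp: dist_commute)
    qed
    then obtain F where F: "F \<subseteq> D" "finite F" "sphere 0 1 \<subseteq> (\<Union>v\<in>F. ball v e)"
      using compactE_image[of "sphere 0 1" D "\<lambda>v. ball v e"] by (metis compact_sphere open_ball)
    have "\<forall>\<^sub>F t in at 0. \<bar>(f (z + t *\<^sub>R v) - f z) / t - a \<bullet> v\<bar> < e" if "v \<in> F" for v
      using dir[of v] that F(1) \<open>e > 0\<close> unfolding directional_derivative_iff tendsto_iff dist_real_def by auto
    then have "\<forall>\<^sub>F t in at 0. \<forall>v\<in>F. \<bar>(f (z + t *\<^sub>R v) - f z) / t - a \<bullet> v\<bar> < e"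
      using F(2) by (simp add: eventually_ball_finite)
    then obtain d where d: "d > 0" "\<And>t v. t \<noteq> 0 \<Longrightarrow> \<bar>t\<bar> < d \<Longrightarrow> v \<in> F \<Longrightarrow>
        \<bar>(f (z + t *\<^sub>R v) - f z) / t - a \<bullet> v\<bar> < e"
      unfolding eventually_at dist_real_def by auto
    show "\<exists>d>0. \<forall>y. norm (y - z) < d \<longrightarrow> norm (f y - f z - a \<bullet> (y - z)) \<le> e' * norm (y - z)"
    proof (intro exI[of _ d] conjI d(1) allI impI)
      fix y assume y: "norm (y - z) < d"
      show "norm (f y - f z - a \<bullet> (y - z)) \<le> e' * norm (y - z)"
      proof (cases "y = z")
        case False
        define t where "t = norm (y - z)"
        define u where "u = (y - z) /\<^sub>R t"
        have t: "t > 0" "t < d" using False y by (auto simp: t_def)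
        have "norm u = 1" unfolding u_def using t by (simp add: t_def)
        then obtain v where v: "v \<in> F" "norm (v - u) < e" using F(3) by (auto simp: subset_iff dist_norm)
        have yu: "y = z + t *\<^sub>R u" unfolding u_def using t by simp
        have "\<bar>(f (z + t *\<^sub>R v) - f z) / t - a \<bullet> v\<bar> < e" using d(2)[of t v] t v by auto
        moreover have "f (z + t *\<^sub>R v) - f z - t * (a \<bullet> v) = ((f (z + t *\<^sub>R v) - f z) / t - a \<bullet> v) * t"
          using t by (simp add: field_simps)
        ultimately have 1: "\<bar>f (z + t *\<^sub>R v) - f z - t * (a \<bullet> v)\<bar> \<le> e * t"
          using t by (simp add: abs_mult)
        have "\<bar>f (z + t *\<^sub>R u) - f (z + t *\<^sub>R v)\<bar> \<le> C * norm (t *\<^sub>R u - t *\<^sub>R v)"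
          using lipschitz_onD[OF lip, of "z + t *\<^sub>R u" "z + t *\<^sub>R v"] by (simp add: dist_norm)
        also have "norm (t *\<^sub>R u - t *\<^sub>R v) = t * norm (v - u)"
          using t by (simp add: scaleR_diff_right[symmetric] norm_minus_commute)
        also have "C * (t * norm (v - u)) \<le> C * (t * e)"
          using C t v by (intro mult_left_mono) auto
        finally have 2: "\<bar>f (z + t *\<^sub>R u) - f (z + t *\<^sub>R v)\<bar> \<le> C * (t * e)" .
        have "\<bar>t * (a \<bullet> v) - t * (a \<bullet> u)\<bar> = t * \<bar>a \<bullet> (v - u)\<bar>"
          using t by (simp add: inner_diff_right abs_mult right_diff_distrib[symmetric])
        also have "\<dots> \<le> t * (norm a * e)"
          using t v by (intro mult_left_mono order_trans[OF Cauchy_Schwarz_ineq2]) auto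
        finally have 3: "\<bar>t * (a \<bullet> v) - t * (a \<bullet> u)\<bar> \<le> t * (norm a * e)" .
        have "\<bar>f (z + t *\<^sub>R u) - f z - t * (a \<bullet> u)\<bar> \<le> e * t + C * (t * e) + t * (norm a * e)"
          using 1 2 3 by linarith
        also have "\<dots> = B * e * t" by (simp add: B_def algebra_simps)
        also have "B * e = e'" using \<open>B > 0\<close> by (simp add: e_def)
        finally show ?thesis using t by (simp add: yu \<open>norm u = 1\<close>)
      qed simp
    qed
  qed
qed

text \<open>The coefficients are fixed before the almost everywhere quantifier: the exceptional null
  set comes from additivity for particular directions and may change with \<open>c\<close>. Hence
  the later restriction to countably many directions.\<close>

lemma lipschitz_AE_directional_derivative_sum:
  fixes f :: "'a::euclidean_space \<Rightarrow> real"
  assumes lip: "C-lipschitz_on UNIV f" and "finite S"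
    and G: "AE z in lborel. \<forall>b\<in>S. ((\<lambda>t. f (z + t *\<^sub>R b)) has_real_derivative G z b) (at 0)"
  shows "AE z in lborel. ((\<lambda>t. f (z + t *\<^sub>R (\<Sum>b\<in>S. c b *\<^sub>R b))) has_real_derivative (\<Sum>b\<in>S. c b * G z b)) (at 0)"
  using \<open>finite S\<close> G
proof (induction S rule: finite_induct)
  case empty
  then show ?case by simp
next
  case (insert b S)
  have "AE z in lborel. ((\<lambda>t. f (z + t *\<^sub>R (\<Sum>b\<in>S. c b *\<^sub>R b))) has_real_derivative (\<Sum>b\<in>S. c b * G z b)) (at 0)"
    using insert.prems by (intro insert.IH) auto
  then show ?case
    using insert.prems lipschitz_directional_derivative_add[OF lip, of "c b *\<^sub>R b" "\<Sum>b\<in>S. c b *\<^sub>R b"]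
  proof eventually_elim
    case (elim z)
    have "((\<lambda>t. f (z + t *\<^sub>R b)) has_real_derivative G z b) (at (0 * c b))"
      using elim(2) by simp
    moreover have "((\<lambda>t. t * c b) has_real_derivative c b) (at 0)"
      by (rule derivative_eq_intros refl | simp)+
    ultimately have "((\<lambda>t. f (z + (t * c b) *\<^sub>R b)) has_real_derivative G z b * c b) (at 0)"
      by (rule DERIV_chain2)
    then have "((\<lambda>t. f (z + t *\<^sub>R (c b *\<^sub>R b))) has_real_derivative c b * G z b) (at 0)"
      by (simp add: mult.commute)
    then show ?case using elim(1,3) insert.hyps by simp
  qed
qed

text \<open>The partial derivatives form the candidate gradient. Off a single null set it predicts
  the derivative in every direction of a countable dense set, and density suffices for total
  differentiability.\<close>

theorem Rademacher_real:
  fixes f :: "'a::euclidean_space \<Rightarrow> real"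
  assumes lip: "C-lipschitz_on UNIV f"
  shows "AE z in lborel. f differentiable (at z)"
proof -
  define G where "G = (\<lambda>z b. SOME D. ((\<lambda>t. f (z + t *\<^sub>R b)) has_real_derivative D) (at 0))"
  obtain D :: "'a set" where D: "countable D" "\<And>X. open X \<Longrightarrow> X \<noteq> {} \<Longrightarrow> \<exists>d\<in>D. d \<in> X"
    using countable_dense_setE by metis
  have "AE z in lborel. ((\<lambda>t. f (z + t *\<^sub>R b)) has_real_derivative G z b) (at 0)" for b
    using lipschitz_AE_directional_derivative[OF lip, of b]
    by eventually_elim (unfold G_def, rule someI_ex)
  then have "AE z in lborel. \<forall>b\<in>Basis. ((\<lambda>t. f (z + t *\<^sub>R b)) has_real_derivative G z b) (at 0)"
    by (intro AE_finite_allI) auto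
  then have "AE z in lborel. ((\<lambda>t. f (z + t *\<^sub>R (\<Sum>b\<in>Basis. (v \<bullet> b) *\<^sub>R b)))
      has_real_derivative (\<Sum>b\<in>Basis. (v \<bullet> b) * G z b)) (at 0)" for v
    by (intro lipschitz_AE_directional_derivative_sum[OF lip]) auto
  then have "AE z in lborel. \<forall>v\<in>D. ((\<lambda>t. f (z + t *\<^sub>R v))
      has_real_derivative (\<Sum>b\<in>Basis. (v \<bullet> b) * G z b)) (at 0)"
    by (simp add: euclidean_representation AE_ball_countable D(1))
  then show ?thesis
  proof eventually_elim
    case (elim z)
    have "(\<Sum>b\<in>Basis. (v \<bullet> b) * G z b) = (\<Sum>b\<in>Basis. G z b *\<^sub>R b) \<bullet> v" for v
      by (simp add: inner_sum_left inner_commute[of v] mult.commute)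
    then have "(f has_derivative (\<lambda>v. (\<Sum>b\<in>Basis. G z b *\<^sub>R b) \<bullet> v)) (at z)"
      using elim by (intro has_derivative_if_directional_on_dense[OF lip D(2)]) auto
    then show ?case by (auto simp: differentiable_def)
  qed
qed

theorem Rademacher:
  fixes f :: "'a::euclidean_space \<Rightarrow> 'b::euclidean_space"
  assumes lip: "C-lipschitz_on UNIV f"
  shows "AE z in lborel. f differentiable (at z)"
proof -
  have "C-lipschitz_on UNIV (\<lambda>z. f z \<bullet> b)" if "b \<in> Basis" for b
  proof (rule lipschitz_onI)
    fix x y
    have "dist (f x \<bullet> b) (f y \<bullet> b) \<le> dist (f x) (f y)"
      using Basis_le_norm[OF that, of "f x - f y"] by (simp add: dist_norm inner_diff_left)
    also have "\<dots> \<le> C * dist x y" using lipschitz_onD[OF lip] by simp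
    finally show "dist (f x \<bullet> b) (f y \<bullet> b) \<le> C * dist x y" .
  qed (rule lipschitz_on_nonneg[OF lip])
  then have "AE z in lborel. \<forall>b\<in>Basis. (\<lambda>z. f z \<bullet> b) differentiable (at z)"
    by (intro AE_finite_allI Rademacher_real) auto
  then show ?thesis
    by (simp add: differentiable_componentwise_within[symmetric])
qed

section \<open>A mean value inequality from almost everywhere bounds\<close>

text \<open>Averaging over a small ball around \<open>y\<close> makes the increment in direction \<open>u\<close> differentiable in the
  step size, even though single lines may consist of bad points.\<close>

lemma lipschitz_increment_ge_AE:
  fixes f :: "'a::euclidean_space \<Rightarrow> real"
  assumes lip: "C-lipschitz_on UNIV f" and S: "open S" "convex S"
    and ae: "AE z in lborel. z \<in> S \<longrightarrow> (\<exists>D\<ge>c. ((\<lambda>t. f (z + t *\<^sub>R u)) has_real_derivative D) (at 0))"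
    and y: "y \<in> S" "y + t *\<^sub>R u \<in> S" "0 \<le> t"
  shows "f (y + t *\<^sub>R u) - f y \<ge> c * t"
proof (rule field_le_epsilon)
  fix e :: real assume "e > 0"
  have C: "C \<ge> 0" using lip by (rule lipschitz_on_nonneg)
  have cont: "continuous_on UNIV f" using lip by (rule lipschitz_on_continuous_on)
  have [measurable]: "f \<in> borel_measurable borel"
    using cont by (rule borel_measurable_continuous_onI)
  have fb: "\<bar>f a - f b\<bar> \<le> C * norm (a - b)" for a b
    using lipschitz_onD[OF lip, of a b] by (simp add: dist_norm)
  obtain r1 where r1: "r1 > 0" "ball y r1 \<subseteq> S" using S y by (meson open_contains_ball)
  obtain r2 where r2: "r2 > 0" "ball (y + t *\<^sub>R u) r2 \<subseteq> S" using S y by (meson open_contains_ball)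
  \<comment> \<open>The ball must fit into \<open>S\<close> around both ends of the segment, and
    replacing \<open>y\<close> by a nearby \<open>z\<close> costs at most \<open>2 * C * r\<close>,
    to be kept below \<open>e\<close>. The added 1 avoids division by zero for
    \<open>C = 0\<close>.\<close>
  define r where "r = min (min r1 r2) (e / (2 * C + 1))"
  have r: "r > 0" "r \<le> r1" "r \<le> r2" "r \<le> e / (2 * C + 1)"
    using r1 r2 \<open>e > 0\<close> C by (auto simp: r_def)
  define A where "A = ball y r"
  have [measurable]: "A \<in> sets borel" unfolding A_def by simp
  let ?I = "indicator A :: 'a \<Rightarrow> real"
  have AS: "z + s *\<^sub>R u \<in> S" if "z \<in> A" "0 \<le> s" "s \<le> t" for z s
  proof (cases "t = 0")
    case True
    then show ?thesis using that r r1 by (auto simp: A_def)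
  next
    case False
    have "z \<in> S" using that(1) r r1 by (auto simp: A_def)
    moreover have "z + t *\<^sub>R u \<in> S" using that(1) r r2 by (auto simp: A_def dist_norm subset_iff)
    ultimately have "(1 - s / t) *\<^sub>R z + (s / t) *\<^sub>R (z + t *\<^sub>R u) \<in> S"
      using that y(3) False by (intro convexD[OF S(2)]) auto
    then show ?thesis using False by (simp add: algebra_simps)
  qed
  have iA: "integrable lborel ?I"
    unfolding A_def by (intro integrable_real_indicator emeasure_bounded_finite) auto
  have iCA: "integrable lborel (\<lambda>z. M * ?I z)" for M :: real
    using iA by (rule integrable_mult_right)
  define H where "H = (\<lambda>s. \<integral>z. ?I z * (f (z + s *\<^sub>R u) - f z) \<partial>lborel)"
  have Hint: "integrable lborel (\<lambda>z. ?I z * (f (z + s *\<^sub>R u) - f z))" for s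
  proof (rule Bochner_Integration.integrable_bound[OF iCA[of "C * norm (s *\<^sub>R u)"]])
    have "\<bar>f (z + s *\<^sub>R u) - f z\<bar> \<le> C * (\<bar>s\<bar> * norm u)" for z
      using fb[of "z + s *\<^sub>R u" z] by simp
    then show "AE z in lborel. norm (?I z * (f (z + s *\<^sub>R u) - f z)) \<le> norm (C * norm (s *\<^sub>R u) * ?I z)"
      using C by (auto simp: indicator_def abs_mult)
  qed measurable
  define g where "g = (\<lambda>z. lim (\<lambda>n. (f (z + inverse (real (Suc n)) *\<^sub>R u) - f z) / inverse (real (Suc n))))"
  have gm[measurable]: "g \<in> borel_measurable borel" unfolding g_def by measurable
  have gD: "g z = D" if "((\<lambda>t. f (z + t *\<^sub>R u)) has_real_derivative D) (at 0)" for z D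
  proof -
    have "filterlim (\<lambda>n. inverse (real (Suc n))) (at 0) sequentially"
      unfolding filterlim_at using LIMSEQ_inverse_real_of_nat by auto
    with that have "(\<lambda>n. (f (z + inverse (real (Suc n)) *\<^sub>R u) - f z) / inverse (real (Suc n))) \<longlonglongrightarrow> D"
      unfolding directional_derivative_iff by (rule filterlim_compose)
    then show ?thesis unfolding g_def by (rule limI)
  qed
  have Hder: "\<exists>D\<ge>c * measure lborel A. (H has_real_derivative D) (at s)" if s: "0 \<le> s" "s \<le> t" for s
  proof -
    have ae': "AE z in lborel. z \<in> A \<longrightarrow> g (z + s *\<^sub>R u) \<ge> c \<and>
        ((\<lambda>h. f (z + s *\<^sub>R u + h *\<^sub>R u)) has_real_derivative g (z + s *\<^sub>R u)) (at 0)"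
      using AE_lborel_translation[OF ae, of "s *\<^sub>R u"]
      by eventually_elim (use AS s gD in blast)
    have b: "AE z in lborel. norm (?I z * ((f (z + s *\<^sub>R u + h *\<^sub>R u) - f (z + s *\<^sub>R u)) / h)) \<le> C * norm u * ?I z" for h
      using lipschitz_quotient_bound[OF lip, of "_ + s *\<^sub>R u" h u] by (auto simp: indicator_def)
    have l: "AE z in lborel. (\<lambda>n. ?I z * ((f (z + s *\<^sub>R u + X n *\<^sub>R u) - f (z + s *\<^sub>R u)) / X n))
        \<longlonglongrightarrow> ?I z * g (z + s *\<^sub>R u)" if "filterlim X (at 0) sequentially" for X :: "nat \<Rightarrow> real"
      using ae'
    proof eventually_elim
      case (elim z)
      show ?case
      proof (cases "z \<in> A")
        case True
        then have "((\<lambda>h. (f (z + s *\<^sub>R u + h *\<^sub>R u) - f (z + s *\<^sub>R u)) / h) \<longlongrightarrow> g (z + s *\<^sub>R u)) (at 0)"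
          using elim unfolding directional_derivative_iff by blast
        then have "(\<lambda>n. (f (z + s *\<^sub>R u + X n *\<^sub>R u) - f (z + s *\<^sub>R u)) / X n) \<longlonglongrightarrow> g (z + s *\<^sub>R u)"
          using that by (rule filterlim_compose)
        then show ?thesis by (rule tendsto_mult_left)
      qed simp
    qed
    have ig: "integrable lborel (\<lambda>z. ?I z * g (z + s *\<^sub>R u))"
    proof (rule integrable_dominated_convergence[OF _ _ iCA l b])
      show "filterlim (\<lambda>n. inverse (real (Suc n))) (at 0) sequentially"
        unfolding filterlim_at using LIMSEQ_inverse_real_of_nat by auto
    qed measurable
    \<comment> \<open>For each fixed \<open>s\<close>, almost every \<open>z\<close> in the ball is
      translated to a good point, and all quotients are bounded by \<open>C * norm u\<close>.
      Dominated convergence therefore differentiates \<open>H\<close> at every \<open>s\<close>, not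
      merely at almost every one, so that monotonicity can be read off the derivative.\<close>
    have "(H has_real_derivative (\<integral>z. ?I z * g (z + s *\<^sub>R u) \<partial>lborel)) (at s)"
      unfolding DERIV_def tendsto_at_iff_sequentially
    proof (intro allI impI)
      fix X :: "nat \<Rightarrow> real" assume X: "\<forall>i. X i \<in> UNIV - {0}" "X \<longlonglongrightarrow> 0"
      have X': "filterlim X (at 0) sequentially" using X by (auto simp: filterlim_at)
      have "(\<lambda>n. \<integral>z. ?I z * ((f (z + s *\<^sub>R u + X n *\<^sub>R u) - f (z + s *\<^sub>R u)) / X n) \<partial>lborel)
          \<longlonglongrightarrow> (\<integral>z. ?I z * g (z + s *\<^sub>R u) \<partial>lborel)"
        by (rule integral_dominated_convergence[OF _ _ iCA l[OF X'] b]) measurable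
      moreover have "(H (s + X n) - H s) / X n =
          (\<integral>z. ?I z * ((f (z + s *\<^sub>R u + X n *\<^sub>R u) - f (z + s *\<^sub>R u)) / X n) \<partial>lborel)" for n
      proof -
        have "H (s + X n) - H s =
            (\<integral>z. ?I z * (f (z + (s + X n) *\<^sub>R u) - f z) - ?I z * (f (z + s *\<^sub>R u) - f z) \<partial>lborel)"
          unfolding H_def by (rule Bochner_Integration.integral_diff[OF Hint Hint, symmetric])
        also have "\<dots> = (\<integral>z. ?I z * (f (z + s *\<^sub>R u + X n *\<^sub>R u) - f (z + s *\<^sub>R u)) \<partial>lborel)"
          by (rule Bochner_Integration.integral_cong) (auto simp: algebra_simps)
        finally show ?thesis by simp
      qed
      ultimately show "((\<lambda>h. (H (s + h) - H s) / h) \<circ> X) \<longlonglongrightarrow> (\<integral>z. ?I z * g (z + s *\<^sub>R u) \<partial>lborel)"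
        by (simp only: o_def)
    qed
    moreover have "(\<integral>z. c * ?I z \<partial>lborel) \<le> (\<integral>z. ?I z * g (z + s *\<^sub>R u) \<partial>lborel)"
      using iCA ig by (rule integral_mono_AE) (use ae' in eventually_elim, auto simp: indicator_def)
    then have "c * measure lborel A \<le> (\<integral>z. ?I z * g (z + s *\<^sub>R u) \<partial>lborel)" by simp
    ultimately show ?thesis by blast
  qed
  have "H 0 - c * measure lborel A * 0 \<le> H t - c * measure lborel A * t"
  proof (rule DERIV_nonneg_imp_nondecreasing[OF y(3), where f="\<lambda>s. H s - c * measure lborel A * s"])
    fix s assume "0 \<le> s" "s \<le> t"
    then obtain D where "D \<ge> c * measure lborel A" "(H has_real_derivative D) (at s)" using Hder by blast
    then show "\<exists>y. ((\<lambda>s. H s - c * measure lborel A * s) has_real_derivative y) (at s) \<and> 0 \<le> y"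
      by (intro exI[of _ "D - c * measure lborel A"]) (auto intro!: derivative_eq_intros)
  qed
  then have "c * t * measure lborel A \<le> H t" by (simp add: H_def mult_ac)
  also have "H t \<le> (\<integral>z. (f (y + t *\<^sub>R u) - f y + 2 * C * r) * ?I z \<partial>lborel)"
    unfolding H_def
  proof (rule integral_mono[OF Hint iCA])
    fix z
    show "?I z * (f (z + t *\<^sub>R u) - f z) \<le> (f (y + t *\<^sub>R u) - f y + 2 * C * r) * ?I z"
    proof (cases "z \<in> A")
      case True
      then have "C * norm (z - y) \<le> C * r"
        using C by (intro mult_left_mono) (auto simp: A_def dist_norm norm_minus_commute)
      then have "f (z + t *\<^sub>R u) - f z \<le> f (y + t *\<^sub>R u) - f y + 2 * C * r"
        using fb[of "z + t *\<^sub>R u" "y + t *\<^sub>R u"] fb[of z y] by simp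
      then show ?thesis using True by simp
    qed simp
  qed
  also have "\<dots> = (f (y + t *\<^sub>R u) - f y + 2 * C * r) * measure lborel A" by simp
  finally have "c * t \<le> f (y + t *\<^sub>R u) - f y + 2 * C * r"
    using content_ball_pos[OF r(1), of y] by (simp add: A_def)
  also have "2 * C * r \<le> e"
    using r(1,4) C by (simp add: field_simps)
  finally show "c * t \<le> f (y + t *\<^sub>R u) - f y + e" by simp
qed

section \<open>Generalized Jacobians\<close>

text \<open>The nearest-point projection onto a closed convex set is 1-Lipschitz, so composing with
  it keeps the constant \<open>C\<close>. The smaller radius is needed because the projection goes
  to a closed ball inside the open one.\<close>

lemma lipschitz_on_ball_extension:
  fixes f :: "'a::euclidean_space \<Rightarrow> 'b::metric_space"
  assumes lip: "C-lipschitz_on (ball x r) f" and "0 \<le> s" "s < r"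
  obtains F where "C-lipschitz_on UNIV F" "\<And>z. z \<in> cball x s \<Longrightarrow> F z = f z"
proof -
  define p where "p = closest_point (cball x s)"
  have p: "p z \<in> cball x s" for z
    unfolding p_def using \<open>0 \<le> s\<close> by (intro closest_point_in_set) auto
  have "C-lipschitz_on UNIV (f \<circ> p)"
  proof (rule lipschitz_onI)
    fix a b
    have "dist ((f \<circ> p) a) ((f \<circ> p) b) \<le> C * dist (p a) (p b)"
      using p[of a] p[of b] \<open>s < r\<close> by (auto intro!: lipschitz_onD[OF lip])
    also have "\<dots> \<le> C * dist a b"
      unfolding p_def using \<open>0 \<le> s\<close>
      by (intro mult_left_mono closest_point_lipschitz lipschitz_on_nonneg[OF lip]) auto
    finally show "dist ((f \<circ> p) a) ((f \<circ> p) b) \<le> C * dist a b" .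
  qed (rule lipschitz_on_nonneg[OF lip])
  moreover have "(f \<circ> p) z = f z" if "z \<in> cball x s" for z
    unfolding p_def using that by (simp add: closest_point_self)
  ultimately show ?thesis by (rule that)
qed

lemma Rademacher_ball:
  fixes f :: "'a::euclidean_space \<Rightarrow> 'b::euclidean_space"
  assumes lip: "C-lipschitz_on (ball x r) f" and "0 \<le> s" "s < r"
  shows "AE z in lborel. z \<in> ball x s \<longrightarrow> f differentiable (at z)"
proof -
  obtain F where F: "C-lipschitz_on UNIV F" "\<And>z. z \<in> cball x s \<Longrightarrow> F z = f z"
    using lipschitz_on_ball_extension[OF assms] by blast
  show ?thesis
    using Rademacher[OF F(1)]
  proof eventually_elim
    case (elim z)
    show ?case
    proof
      assume "z \<in> ball x s"
      moreover obtain D where "(F has_derivative D) (at z)" using elim by (auto simp: differentiable_def)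
      ultimately have "(f has_derivative D) (at z)"
        by (intro has_derivative_transform_within_open[where f=F and g=f and s="ball x s"]) (auto simp: F(2))
      then show "f differentiable (at z)" by (auto simp: differentiable_def)
    qed
  qed
qed

lemma has_derivative_imp_directional:
  fixes f :: "'a::real_normed_vector \<Rightarrow> 'b::real_inner"
  assumes "(f has_derivative D) (at z)"
  shows "((\<lambda>t. w \<bullet> f (z + t *\<^sub>R u)) has_real_derivative (w \<bullet> D u)) (at 0)"
proof -
  have D: "bounded_linear D" using assms by (rule has_derivative_bounded_linear)
  have "((\<lambda>t. z + t *\<^sub>R u) has_derivative (\<lambda>t. t *\<^sub>R u)) (at 0)"
    by (rule derivative_eq_intros refl | simp)+
  then have "((\<lambda>t. f (z + t *\<^sub>R u)) has_derivative (\<lambda>t. D (t *\<^sub>R u))) (at 0)"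
    by (rule has_derivative_compose) (use assms in simp)
  then have "((\<lambda>t. w \<bullet> f (z + t *\<^sub>R u)) has_derivative (\<lambda>t. w \<bullet> D (t *\<^sub>R u))) (at 0)"
    by (rule has_derivative_inner_right)
  moreover have "(\<lambda>t. w \<bullet> D (t *\<^sub>R u)) = (*) (w \<bullet> D u)"
    using D by (auto simp: linear_cmul bounded_linear.linear mult.commute)
  ultimately show ?thesis by (simp add: has_field_derivative_def)
qed

text \<open>Testing the increments of \<open>f\<close> against the vector
  \<open>jacobian f (at z) *v v\<close> itself produces its squared norm on the left and one factor
  of its norm on the right.\<close>

lemma jacobian_norm_le:
  fixes f :: "real^'n \<Rightarrow> real^'m"
  assumes lip: "C-lipschitz_on (ball x r) f" and z: "z \<in> ball x r" and diff: "f differentiable (at z)"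
  shows "norm (jacobian f (at z) *v v) \<le> C * norm v"
proof -
  let ?J = "jacobian f (at z)"
  let ?w = "?J *v v"
  have "(f has_derivative (\<lambda>h. ?J *v h)) (at z)" using diff by (simp add: jacobian_works)
  then have "((\<lambda>t. ?w \<bullet> f (z + t *\<^sub>R v)) has_real_derivative (?w \<bullet> ?w)) (at 0)"
    by (rule has_derivative_imp_directional)
  then have "((\<lambda>t. (?w \<bullet> f (z + t *\<^sub>R v) - ?w \<bullet> f z) / t) \<longlongrightarrow> ?w \<bullet> ?w) (at 0)"
    by (simp add: DERIV_def)
  moreover have "\<forall>\<^sub>F t in at 0. (?w \<bullet> f (z + t *\<^sub>R v) - ?w \<bullet> f z) / t \<le> norm ?w * (C * norm v)"
  proof -
    have "((\<lambda>t. z + t *\<^sub>R v) \<longlongrightarrow> z + 0 *\<^sub>R v) (at 0)" by (intro tendsto_intros)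
    then have "\<forall>\<^sub>F t in at 0. z + t *\<^sub>R v \<in> ball x r"
      using z by (intro topological_tendstoD) auto
    moreover have "\<forall>\<^sub>F t in at (0::real). t \<noteq> 0" by (simp add: eventually_at_filter)
    ultimately show ?thesis
    proof eventually_elim
      case (elim t)
      have "\<bar>?w \<bullet> (f (z + t *\<^sub>R v) - f z)\<bar> \<le> norm ?w * norm (f (z + t *\<^sub>R v) - f z)"
        by (rule Cauchy_Schwarz_ineq2)
      also have "\<dots> \<le> norm ?w * (C * norm (t *\<^sub>R v))"
        using lipschitz_onD[OF lip elim(1) z] by (intro mult_left_mono) (auto simp: dist_norm)
      finally have "\<bar>(?w \<bullet> f (z + t *\<^sub>R v) - ?w \<bullet> f z) / t\<bar> \<le> norm ?w * (C * norm v)"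
        using elim(2) by (simp add: inner_diff_right field_simps)
      then show ?case by linarith
    qed
  qed
  ultimately have "?w \<bullet> ?w \<le> norm ?w * (C * norm v)"
    by (rule tendsto_upperbound) simp
  then have "norm ?w * norm ?w \<le> norm ?w * (C * norm v)"
    by (simp add: dot_square_norm power2_eq_square)
  then show ?thesis
    by (cases "?w = 0") (use lipschitz_on_nonneg[OF lip] in auto)
qed

text \<open>The generating set of the generalized Jacobian. Compactness is proved here and passes to
  the convex hull in finite dimensions.\<close>

definition jacobian_limits :: "(real^'n \<Rightarrow> real^'n) \<Rightarrow> real^'n \<Rightarrow> (real^'n^'n) set" where
  "jacobian_limits f x = {M. \<exists>X. (\<forall>i::nat. f differentiable (at (X i))) \<and> X \<longlonglongrightarrow> x \<and>
          (\<lambda>i. jacobian f (at (X i))) \<longlonglongrightarrow> M}"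

lemma generalized_jacobian_eq: "generalized_jacobian f x = convex hull (jacobian_limits f x)"
  unfolding generalized_jacobian_def jacobian_limits_def ..

lemma jacobian_in_generalized_jacobian:
  assumes "f differentiable (at z)"
  shows "jacobian f (at z) \<in> generalized_jacobian f z"
  unfolding generalized_jacobian_eq using assms
  by (intro hull_inc) (auto simp: jacobian_limits_def intro!: exI[of _ "\<lambda>_. z"])

text \<open>The set is the slice over \<open>x\<close> of the closure of the graph of the Jacobian,
  which avoids a diagonal argument.\<close>

lemma closed_jacobian_limits: "closed (jacobian_limits f x)"
proof -
  let ?G = "(\<lambda>z. (z, jacobian f (at z))) ` {z. f differentiable (at z)}"
  have "jacobian_limits f x = Pair x -` closure ?G"
  proof (intro set_eqI iffI)
    fix M assume "M \<in> jacobian_limits f x"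
    then obtain X where "\<forall>i. f differentiable (at (X i))" "X \<longlonglongrightarrow> x" "(\<lambda>i. jacobian f (at (X i))) \<longlonglongrightarrow> M"
      unfolding jacobian_limits_def by blast
    then show "M \<in> Pair x -` closure ?G"
      unfolding vimage_eq closure_sequential
      by (intro exI[of _ "\<lambda>i. (X i, jacobian f (at (X i)))"]) (auto intro: tendsto_Pair)
  next
    fix M assume "M \<in> Pair x -` closure ?G"
    then obtain Y where Y: "\<And>n. Y n \<in> ?G" "Y \<longlonglongrightarrow> (x, M)"
      unfolding vimage_eq closure_sequential by blast
    have "f differentiable (at (fst (Y n))) \<and> snd (Y n) = jacobian f (at (fst (Y n)))" for n
      using Y(1)[of n] by auto
    moreover have "(\<lambda>n. fst (Y n)) \<longlonglongrightarrow> x" "(\<lambda>n. snd (Y n)) \<longlonglongrightarrow> M"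
      using tendsto_fst[OF Y(2)] tendsto_snd[OF Y(2)] by auto
    ultimately show "M \<in> jacobian_limits f x"
      unfolding jacobian_limits_def by (auto intro!: exI[of _ "\<lambda>n. fst (Y n)"])
  qed
  then show ?thesis
    by (simp add: closed_vimage continuous_on_Pair)
qed

lemma compact_matrix_norm_le: "compact {M::real^'n^'m. \<forall>v. norm (M *v v) \<le> C * norm v}"
proof -
  have "closed {M::real^'n^'m. \<forall>v. norm (M *v v) \<le> C * norm v}"
    unfolding matrix_vector_mult_def by (intro closed_Collect_all closed_Collect_le continuous_intros)
  moreover have "bounded {M::real^'n^'m. \<forall>v. norm (M *v v) \<le> C * norm v}"
  proof (rule boundedI)
    fix M :: "real^'n^'m" assume "M \<in> {M. \<forall>v. norm (M *v v) \<le> C * norm v}"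
    then have "onorm ((*v) M) \<le> C" by (intro onorm_le) auto
    then have c: "\<bar>M $ i $ j\<bar> \<le> C" for i j
      using matrix_component_le_onorm order_trans by blast
    have "norm M \<le> (\<Sum>i\<in>UNIV. norm (M $ i))" unfolding norm_vec_def by (rule L2_set_le_sum) simp
    also have "\<dots> \<le> (\<Sum>i\<in>(UNIV::'m set). \<Sum>j\<in>(UNIV::'n set). C)"
      by (intro sum_mono order_trans[OF norm_le_l1_cart] c)
    finally show "norm M \<le> (\<Sum>i\<in>(UNIV::'m set). \<Sum>j\<in>(UNIV::'n set). C)" .
  qed
  ultimately show ?thesis by (simp add: compact_eq_bounded_closed)
qed

text \<open>All limits of Jacobians inherit the operator norm bound \<open>C\<close>, so they form a
  closed subset of a compact set. For nonemptiness, Rademacher's theorem supplies differentiability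
  points in every small ball around \<open>x\<close>, and the same compact set supplies a convergent
  subsequence of their Jacobians.\<close>

lemma
  fixes f :: "real^'n \<Rightarrow> real^'n"
  assumes lip: "C-lipschitz_on (ball x r) f" and "r > 0"
  shows compact_generalized_jacobian: "compact (generalized_jacobian f x)"
    and generalized_jacobian_nonempty: "generalized_jacobian f x \<noteq> {}"
proof -
  let ?B = "{M::real^'n^'n. \<forall>v. norm (M *v v) \<le> C * norm v}"
  have "jacobian_limits f x \<subseteq> ?B"
  proof
    fix M assume "M \<in> jacobian_limits f x"
    then obtain X where X: "\<And>i. f differentiable (at (X i))" "X \<longlonglongrightarrow> x" "(\<lambda>i. jacobian f (at (X i))) \<longlonglongrightarrow> M"
      unfolding jacobian_limits_def by blast
    have "closed ?B" by (rule compact_imp_closed[OF compact_matrix_norm_le])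
    moreover have "\<forall>\<^sub>F i in sequentially. X i \<in> ball x r"
      using X(2) \<open>r > 0\<close> by (intro topological_tendstoD) auto
    then have "\<forall>\<^sub>F i in sequentially. jacobian f (at (X i)) \<in> ?B"
      by eventually_elim (use jacobian_norm_le[OF lip _ X(1)] in auto)
    ultimately show "M \<in> ?B"
      using X(3) by (intro Lim_in_closed_set[of ?B]) auto
  qed
  then have "jacobian_limits f x = ?B \<inter> jacobian_limits f x" by blast
  moreover have "compact (?B \<inter> jacobian_limits f x)"
    by (intro compact_Int_closed compact_matrix_norm_le closed_jacobian_limits)
  ultimately have "compact (jacobian_limits f x)" by simp
  then show "compact (generalized_jacobian f x)"
    unfolding generalized_jacobian_eq by (rule compact_convex_hull)
  \<comment> \<open>The extra factor 1/2 matters at \<open>n = 0\<close>, where the radius would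
    otherwise be \<open>r\<close> itself and Rademacher's theorem is available only on strictly
    smaller balls.\<close>
  have less: "r * inverse (real (Suc n)) / 2 < r" for n
  proof -
    have "inverse (real (Suc n)) / 2 < 1" by (simp add: field_simps)
    then show ?thesis using \<open>r > 0\<close> mult_strict_left_mono[of "inverse (real (Suc n)) / 2" 1 r] by simp
  qed
  have "\<exists>z. z \<in> ball x (r * inverse (real (Suc n)) / 2) \<and> f differentiable (at z)" for n
  proof (rule ccontr)
    let ?s = "r * inverse (real (Suc n)) / 2"
    assume no: "\<not> ?thesis"
    have s: "0 < ?s" "?s < r" using less[of n] \<open>r > 0\<close> by auto
    have "AE z in lborel. z \<notin> ball x ?s"
      using Rademacher_ball[OF lip less_imp_le[OF s(1)] s(2)]
      by (rule eventually_mono) (use no in blast)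
    then have "emeasure lborel (ball x ?s) = 0"
      by (subst (asm) AE_iff_measurable[where N="ball x ?s"]) auto
    then show False using content_ball_pos[OF s(1), of x] by (simp add: measure_def)
  qed
  then obtain X where X: "\<And>n. X n \<in> ball x (r * inverse (real (Suc n)) / 2)" "\<And>n. f differentiable (at (X n))"
    by metis
  have "X \<longlonglongrightarrow> x"
  proof (rule metric_tendsto_imp_tendsto)
    show "(\<lambda>n. r * inverse (real (Suc n)) / 2) \<longlonglongrightarrow> 0"
      using tendsto_mult[OF tendsto_const[of "r / 2"] LIMSEQ_inverse_real_of_nat] by (simp add: mult_ac)
    show "\<forall>\<^sub>F n in sequentially. dist (X n) x \<le> dist (r * inverse (real (Suc n)) / 2) 0"
      using X(1) \<open>r > 0\<close> by (intro always_eventually) (auto simp: dist_commute less_imp_le)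
  qed
  have "X n \<in> ball x r" for n
    using X(1)[of n] less[of n] by auto
  then have "jacobian f (at (X n)) \<in> ?B" for n
    using jacobian_norm_le[OF lip _ X(2)] by auto
  then obtain M \<sigma> where M: "strict_mono \<sigma>" "((\<lambda>n. jacobian f (at (X n))) \<circ> \<sigma>) \<longlonglongrightarrow> M"
    using seq_compactE[of ?B "\<lambda>n. jacobian f (at (X n))"] compact_matrix_norm_le[of C]
    unfolding compact_eq_seq_compact_metric by blast
  have "M \<in> jacobian_limits f x"
    unfolding jacobian_limits_def using X(2) M(2) LIMSEQ_subseq_LIMSEQ[OF \<open>X \<longlonglongrightarrow> x\<close> M(1)]
    by (auto simp: o_def intro!: exI[of _ "X \<circ> \<sigma>"])
  then show "generalized_jacobian f x \<noteq> {}"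
    unfolding generalized_jacobian_eq by auto
qed

section \<open>Uniform invertibility of a compact set of matrices\<close>

lemma matrix_inv_mult_vec:
  fixes A :: "real^'n^'n"
  assumes "invertible A"
  shows "matrix_inv A *v (A *v v) = v" "A *v (matrix_inv A *v v) = v"
proof -
  have "A ** matrix_inv A = mat 1 \<and> matrix_inv A ** A = mat 1"
    unfolding matrix_inv_def using assms unfolding invertible_def by (rule someI_ex)
  then show "matrix_inv A *v (A *v v) = v" "A *v (matrix_inv A *v v) = v"
    by (simp_all add: matrix_vector_mul_assoc)
qed

lemma norm_matrix_vector_le_matrix_norm: "norm (A *v v) \<le> matrix_norm A * norm v"
  unfolding matrix_norm_def by (rule onorm) (rule matrix_vector_mul_bounded_linear)

lemma matrix_norm_matrix_inv_pos:
  fixes A :: "real^'n^'n"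
  assumes "invertible A"
  shows "matrix_norm (matrix_inv A) > 0"
proof (rule ccontr)
  assume np: "\<not> matrix_norm (matrix_inv A) > 0"
  obtain v :: "real^'n" where "norm v = 1" using vector_choose_size[of 1] by auto
  have "norm v = norm (matrix_inv A *v (A *v v))" by (simp add: matrix_inv_mult_vec assms)
  also have "\<dots> \<le> matrix_norm (matrix_inv A) * norm (A *v v)" by (rule norm_matrix_vector_le_matrix_norm)
  also have "\<dots> \<le> 0" using np by (simp add: mult_nonpos_nonneg)
  finally show False using \<open>norm v = 1\<close> by simp
qed

text \<open>The reciprocal of the norm of the inverse is the least stretching of a unit vector. Over
  \<open>S\<close> and the unit sphere together the stretching attains its minimum, which
  invertibility keeps away from 0, so the infimum of the reciprocals is positive too.\<close>

lemma
  fixes S :: "(real^'n^'n) set"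
  assumes "compact S" "S \<noteq> {}" and inv: "\<forall>M\<in>S. invertible M"
  shows INF_inverse_matrix_norm_pos: "0 < (INF M\<in>S. 1 / matrix_norm (matrix_inv M))"
    and INF_inverse_matrix_norm_le: "M \<in> S \<Longrightarrow> (INF M\<in>S. 1 / matrix_norm (matrix_inv M)) * norm v \<le> norm (M *v v)"
proof -
  let ?I = "INF M\<in>S. 1 / matrix_norm (matrix_inv M)"
  let ?T = "S \<times> sphere (0 :: real^'n) 1"
  obtain e :: "real^'n" where "norm e = 1" using vector_choose_size[of 1] by auto
  then have "?T \<noteq> {}" using assms(2) by auto
  moreover have "compact ?T" using assms(1) by (intro compact_Times) auto
  moreover have "continuous_on ?T (\<lambda>p. norm (fst p *v snd p))"
    unfolding matrix_vector_mult_def by (intro continuous_intros)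
  ultimately obtain p where p: "p \<in> ?T" "\<forall>q\<in>?T. norm (fst p *v snd p) \<le> norm (fst q *v snd q)"
    using continuous_attains_inf by blast
  define m where "m = norm (fst p *v snd p)"
  have "m \<noteq> 0"
  proof
    assume "m = 0"
    then have "fst p *v snd p = 0" by (simp add: m_def)
    then have "matrix_inv (fst p) *v 0 = snd p"
      using matrix_inv_mult_vec(1)[of "fst p" "snd p"] p(1) inv by (auto simp: mem_Times_iff)
    then show False using p(1) by (auto simp: mem_Times_iff)
  qed
  then have "m > 0" by (simp add: m_def)
  have m: "m * norm v \<le> norm (M *v v)" if "M \<in> S" for M v
  proof (cases "v = 0")
    case False
    have "m \<le> norm (M *v (v /\<^sub>R norm v))"
      using p(2)[rule_format, of "(M, v /\<^sub>R norm v)"] that False by (simp add: m_def)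
    also have "\<dots> = norm (M *v v) / norm v"
      by (simp add: matrix_vector_mult_scaleR divide_inverse mult.commute)
    finally show ?thesis using False by (simp add: field_simps)
  qed simp
  have ge: "m \<le> 1 / matrix_norm (matrix_inv M)" if "M \<in> S" for M
  proof -
    have "matrix_norm (matrix_inv M) \<le> 1 / m"
      unfolding matrix_norm_def
    proof (rule onorm_le)
      fix v
      show "norm (matrix_inv M *v v) \<le> 1 / m * norm v"
        using m[OF that, of "matrix_inv M *v v"] matrix_inv_mult_vec(2)[of M v] that inv \<open>m > 0\<close>
        by (simp add: field_simps)
    qed
    then show ?thesis
      using matrix_norm_matrix_inv_pos[of M] that inv \<open>m > 0\<close> by (simp add: field_simps)
  qed
  then have "m \<le> ?I" using assms(2) by (intro cINF_greatest)
  then show "0 < ?I" using \<open>m > 0\<close> by linarith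
  show "?I * norm v \<le> norm (M *v v)" if M: "M \<in> S"
  proof -
    have pos: "matrix_norm (matrix_inv M) > 0" using matrix_norm_matrix_inv_pos M inv by blast
    have "?I \<le> 1 / matrix_norm (matrix_inv M)"
      by (rule cINF_lower) (use ge M in \<open>auto intro!: bdd_belowI2\<close>)
    then have "?I * norm v \<le> 1 / matrix_norm (matrix_inv M) * norm v"
      by (intro mult_right_mono) auto
    also have "norm v \<le> matrix_norm (matrix_inv M) * norm (M *v v)"
      using norm_matrix_vector_le_matrix_norm[of "matrix_inv M" "M *v v"] M inv
      by (simp add: matrix_inv_mult_vec)
    then have "1 / matrix_norm (matrix_inv M) * norm v \<le> norm (M *v v)"
      using pos by (simp add: field_simps)
    finally show ?thesis .
  qed
qed

text \<open>The point of the convex set \<open>{M u | M \<in> S}\<close> closest to the origin gives the direction \<open>w\<close>.\<close>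

lemma matrix_set_separating_direction:
  fixes S :: "(real^'n^'n) set"
  assumes "compact S" "convex S" "S \<noteq> {}" and "d > 0"
    and ge: "\<And>M. M \<in> S \<Longrightarrow> d \<le> norm (M *v u)"
  obtains w where "norm w = 1" "\<And>M. M \<in> S \<Longrightarrow> d \<le> w \<bullet> (M *v u)"
proof -
  let ?T = "(\<lambda>M. M *v u) ` S"
  have lin: "linear (\<lambda>M::real^'n^'n. M *v u)"
    by (rule linearI) (auto simp: matrix_vector_mult_add_rdistrib scaleR_matrix_vector_assoc)
  have cl: "closed ?T"
    using assms(1) lin by (intro compact_imp_closed compact_continuous_image linear_continuous_on) (simp_all add: linear_conv_bounded_linear)
  have cv: "convex ?T" using assms(2) lin by (intro convex_linear_image)
  obtain p where p: "p \<in> ?T" "\<And>y. y \<in> ?T \<Longrightarrow> dist 0 p \<le> dist 0 y"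
    using distance_attains_inf[OF cl, of 0] assms(3) by blast
  have np: "norm p \<ge> d" using p(1) ge by auto
  have "d \<le> (p /\<^sub>R norm p) \<bullet> (M *v u)" if "M \<in> S" for M
  proof -
    \<comment> \<open>The variational inequality for the nearest point \<open>p\<close>: no point of
      the convex set lies on the near side of the hyperplane through \<open>p\<close> orthogonal to
      \<open>p\<close>.\<close>
    have "(0 - p) \<bullet> (M *v u - p) \<le> 0"
      by (rule any_closest_point_dot[OF cv cl p(1)]) (use that p(2) in auto)
    then have "norm p * norm p \<le> p \<bullet> (M *v u)"
      by (simp add: inner_diff_right dot_square_norm power2_eq_square)
    then have "norm p \<le> (p \<bullet> (M *v u)) / norm p"
      using np \<open>d > 0\<close> by (subst pos_le_divide_eq) auto
    also have "\<dots> = (p /\<^sub>R norm p) \<bullet> (M *v u)" by (simp add: divide_inverse mult.commute)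
    finally show ?thesis using np by linarith
  qed
  moreover have "norm (p /\<^sub>R norm p) = 1"
    using np \<open>d > 0\<close> by (simp, intro left_inverse) auto
  ultimately show ?thesis using that by blast
qed

text \<open>One unit vector \<open>w\<close>, chosen for the direction of \<open>x - y\<close>,
  gives at least 2 \<delta> on all matrices at \<open>x0\<close>; the perturbation
  \<open>\<delta> *\<^sub>R B\<close> lowers this by at most \<delta>. Thus
  \<open>w \<bullet> f\<close> grows at rate at least \<delta> in that direction almost everywhere
  in the ball, and Cauchy-Schwarz returns from \<open>w \<bullet> f\<close> to
  \<open>f\<close>.\<close>

lemma Clarke_lower_bound:
  fixes f :: "real^'n \<Rightarrow> real^'n"
  assumes lip: "C-lipschitz_on (ball x0 r) f" and "r > 0" and "\<delta> > 0"
    and ge: "\<And>M v. M \<in> generalized_jacobian f x0 \<Longrightarrow> 2 * \<delta> * norm v \<le> norm (M *v v)"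
    and near: "\<forall>x\<in>ball x0 r. generalized_jacobian f x \<subseteq>
           {M0 + \<delta> *\<^sub>R B | M0 B. M0 \<in> generalized_jacobian f x0 \<and> B \<in> matrix_unit_ball}"
    and x: "x \<in> ball x0 r" and y: "y \<in> ball x0 r"
  shows "\<delta> * norm (x - y) \<le> norm (f x - f y)"
proof (cases "x = y")
  case False
  define t where "t = norm (x - y)"
  define u where "u = (x - y) /\<^sub>R t"
  have t: "t > 0" using False by (simp add: t_def)
  have u: "norm u = 1" "x = y + t *\<^sub>R u" using t by (auto simp: u_def t_def)
  let ?S = "generalized_jacobian f x0"
  have cS: "compact ?S" "convex ?S" "?S \<noteq> {}"
    using compact_generalized_jacobian[OF lip \<open>r > 0\<close>] generalized_jacobian_nonempty[OF lip \<open>r > 0\<close>]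
    by (auto simp: generalized_jacobian_def convex_convex_hull)
  obtain w where w: "norm w = 1" "\<And>M. M \<in> ?S \<Longrightarrow> 2 * \<delta> \<le> w \<bullet> (M *v u)"
    using matrix_set_separating_direction[OF cS, of "2 * \<delta>" u] ge[of _ u] u(1) \<open>\<delta> > 0\<close> by auto
  have J: "\<delta> \<le> w \<bullet> (jacobian f (at z) *v u)" if z: "z \<in> ball x0 r" "f differentiable (at z)" for z
  proof -
    obtain M0 B where MB: "jacobian f (at z) = M0 + \<delta> *\<^sub>R B" "M0 \<in> ?S" "B \<in> matrix_unit_ball"
      using near z jacobian_in_generalized_jacobian[of f z] by blast
    have "\<bar>w \<bullet> (B *v u)\<bar> \<le> norm w * norm (B *v u)" by (rule Cauchy_Schwarz_ineq2)
    also have "norm (B *v u) \<le> 1"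
      using norm_matrix_vector_le_matrix_norm[of B u] MB(3) u(1) by (simp add: matrix_unit_ball_def)
    finally have "w \<bullet> (B *v u) \<ge> - 1" using w(1) by (simp add: abs_le_iff)
    then have "\<delta> * (w \<bullet> (B *v u)) \<ge> \<delta> * (- 1)" using \<open>\<delta> > 0\<close> by (intro mult_left_mono) auto
    moreover have "2 * \<delta> \<le> w \<bullet> (M0 *v u)" using w(2) MB(2) .
    moreover have "w \<bullet> (jacobian f (at z) *v u) = w \<bullet> (M0 *v u) + \<delta> * (w \<bullet> (B *v u))"
      by (simp add: MB(1) matrix_vector_mult_add_rdistrib scaleR_matrix_vector_assoc[symmetric] inner_add_right)
    ultimately show ?thesis by linarith
  qed
  \<comment> \<open>An intermediate radius: the smaller ball still contains both points, and on it
    \<open>f\<close> agrees with a globally Lipschitz map.\<close>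
  obtain s where s: "max (dist x0 x) (dist x0 y) < s" "s < r" using x y dense[of "max (dist x0 x) (dist x0 y)" r] by auto
  have "0 < s" using s(1) zero_le_dist[of x0 x] by linarith
  obtain F where F: "C-lipschitz_on UNIV F" "\<And>z. z \<in> cball x0 s \<Longrightarrow> F z = f z"
    using lipschitz_on_ball_extension[OF lip, of s] \<open>0 < s\<close> s by auto
  have lipw: "C-lipschitz_on UNIV (\<lambda>z. w \<bullet> F z)"
  proof (rule lipschitz_onI)
    fix a b
    have "\<bar>w \<bullet> (F a - F b)\<bar> \<le> norm w * norm (F a - F b)" by (rule Cauchy_Schwarz_ineq2)
    then show "dist (w \<bullet> F a) (w \<bullet> F b) \<le> C * dist a b"
      using lipschitz_onD[OF F(1), of a b] w(1) by (simp add: dist_norm inner_diff_right)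
  qed (rule lipschitz_on_nonneg[OF lip])
  have "AE z in lborel. z \<in> ball x0 s \<longrightarrow>
      (\<exists>D\<ge>\<delta>. ((\<lambda>t. w \<bullet> F (z + t *\<^sub>R u)) has_real_derivative D) (at 0))"
    using Rademacher_ball[OF lip, of s]
  proof (rule AE_mp)
    show "AE z in lborel. (z \<in> ball x0 s \<longrightarrow> f differentiable (at z)) \<longrightarrow> z \<in> ball x0 s \<longrightarrow>
      (\<exists>D\<ge>\<delta>. ((\<lambda>t. w \<bullet> F (z + t *\<^sub>R u)) has_real_derivative D) (at 0))"
    proof (intro AE_I2 impI)
      fix z assume z: "z \<in> ball x0 s \<longrightarrow> f differentiable (at z)" "z \<in> ball x0 s"
      then have "(f has_derivative (\<lambda>h. jacobian f (at z) *v h)) (at z)"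
        by (simp add: jacobian_works)
      then have "(F has_derivative (\<lambda>h. jacobian f (at z) *v h)) (at z)"
        by (rule has_derivative_transform_within_open[where s="ball x0 s"]) (use z in \<open>auto simp: F(2)\<close>)
      then have "((\<lambda>t. w \<bullet> F (z + t *\<^sub>R u)) has_real_derivative (w \<bullet> (jacobian f (at z) *v u))) (at 0)"
        by (rule has_derivative_imp_directional)
      moreover have "\<delta> \<le> w \<bullet> (jacobian f (at z) *v u)"
        using z s by (intro J) auto
      ultimately show "\<exists>D\<ge>\<delta>. ((\<lambda>t. w \<bullet> F (z + t *\<^sub>R u)) has_real_derivative D) (at 0)" by blast
    qed
  qed (use \<open>0 < s\<close> s in auto)
  then have "w \<bullet> F (y + t *\<^sub>R u) - w \<bullet> F y \<ge> \<delta> * t"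
    by (intro lipschitz_increment_ge_AE[OF lipw, where S="ball x0 s"]) (use s t u(2) in auto)
  then have "\<delta> * t \<le> w \<bullet> (f x - f y)"
    using F(2)[of x] F(2)[of y] s by (simp add: u(2)[symmetric] inner_diff_right)
  also have "\<dots> \<le> norm w * norm (f x - f y)" by (rule norm_cauchy_schwarz)
  finally show ?thesis using w(1) by (simp add: t_def)
qed simp

section \<open>The inverse function theorem\<close>

text \<open>Inside the connected target ball the image is open by invariance of domain. It is also
  relatively closed, because the image of the closed ball is compact and its boundary sphere is
  thrown out of the target.\<close>

lemma ball_subset_image_of_expanding:
  fixes f :: "'a::euclidean_space \<Rightarrow> 'a"
  assumes cont: "continuous_on (cball x0 \<rho>) f" and "\<rho> > 0" and "\<delta> > 0"
    and low: "\<And>x y. x \<in> cball x0 \<rho> \<Longrightarrow> y \<in> cball x0 \<rho> \<Longrightarrow> \<delta> * norm (x - y) \<le> norm (f x - f y)"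
  shows "ball (f x0) (\<delta> * \<rho>) \<subseteq> f ` ball x0 \<rho>"
proof -
  let ?V = "ball (f x0) (\<delta> * \<rho>)"
  have inj: "inj_on f (cball x0 \<rho>)"
  proof (rule inj_onI)
    fix x y assume "x \<in> cball x0 \<rho>" "y \<in> cball x0 \<rho>" "f x = f y"
    then have "\<delta> * norm (x - y) \<le> 0" using low[of x y] by simp
    then show "x = y" using \<open>\<delta> > 0\<close> by (simp add: mult_le_0_iff)
  qed
  \<comment> \<open>A boundary point is at distance \<rho> from \<open>x0\<close>, so its image is
    at distance at least \<open>\<delta> * \<rho>\<close> from \<open>f x0\<close>, and the target
    ball is open.\<close>
  have eq: "?V \<inter> f ` cball x0 \<rho> = ?V \<inter> f ` ball x0 \<rho>"
  proof -
    have "x \<in> ball x0 \<rho>" if "x \<in> cball x0 \<rho>" "f x \<in> ?V" for x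
    proof -
      have "\<delta> * norm (x - x0) < \<delta> * \<rho>"
        using low[OF that(1), of x0] that(2) \<open>\<rho> > 0\<close> by (simp add: dist_norm norm_minus_commute)
      then show ?thesis using \<open>\<delta> > 0\<close> by (simp add: dist_norm norm_minus_commute)
    qed
    then show ?thesis using ball_subset_cball[of x0 \<rho>] by blast
  qed
  have "open (f ` ball x0 \<rho>)"
    by (rule invariance_of_domain)
      (use cont inj ball_subset_cball[of x0 \<rho>] in \<open>auto intro: continuous_on_subset inj_on_subset\<close>)
  then have "openin (top_of_set ?V) (?V \<inter> f ` ball x0 \<rho>)" by (rule openin_open_Int)
  moreover have "closed (f ` cball x0 \<rho>)"
    using cont by (intro compact_imp_closed compact_continuous_image) auto
  then have "closedin (top_of_set ?V) (?V \<inter> f ` ball x0 \<rho>)"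
    unfolding eq[symmetric] by (rule closedin_closed_Int)
  moreover have "connected ?V" by (rule connected_ball)
  moreover have "f x0 \<in> ?V \<inter> f ` ball x0 \<rho>" using \<open>\<rho> > 0\<close> \<open>\<delta> > 0\<close> by auto
  ultimately have "?V \<inter> f ` ball x0 \<rho> = ?V"
    unfolding connected_clopen by blast
  then show ?thesis by blast
qed

theorem theorem3p8:
  fixes f0 h f :: "real^'n \<Rightarrow> real^'n"
    and x0 :: "real^'n" and N :: "(real^'n) set"
    and K K' L \<delta> r :: real
  assumes "open N" and "x0 \<in> N"
    and "\<exists>C. C-lipschitz_on N f0"
    and "maximal_rank (generalized_jacobian f0 x0)"
    and "\<forall>x\<in>N. \<forall>y\<in>N. K * norm (x - y) \<le> norm (f0 x - f0 y) \<and>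
                        norm (f0 x - f0 y) \<le> K' * norm (x - y)"
    and "L-lipschitz_on UNIV h" and "L < K"
    and "f = (\<lambda>x. f0 x + h x)"
    (* M0^{-1} exists for every M0 occurring in the definition of delta *)
    and "maximal_rank (generalized_jacobian f x0)"
    and "\<delta> = 1/2 * (INF M0\<in>generalized_jacobian f x0. 1 / matrix_norm (matrix_inv M0))"
    and "r > 0"
    and "\<exists>C. C-lipschitz_on (ball x0 r) f"
    and "\<forall>x\<in>ball x0 r. generalized_jacobian f x \<subseteq>
           {M0 + \<delta> *\<^sub>R B | M0 B. M0 \<in> generalized_jacobian f x0 \<and> B \<in> matrix_unit_ball}"
    (* U lies in the neighbourhood in which the two-sided estimate for f0 holds *)
    and "ball x0 (r * \<delta> / 2 * (1 / (K' + L))) \<subseteq> N"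
  shows "\<exists>U V g.
           U = ball x0 (r * \<delta> / 2 * (1 / (K' + L))) \<and>
           V = ball (f x0) (r * \<delta> / 2) \<and>
           open U \<and> x0 \<in> U \<and> open V \<and> f x0 \<in> V \<and>
           (\<exists>C. C-lipschitz_on V g) \<and> lipschitz_constant V g \<le> 1 / \<delta> \<and>
           (\<forall>u\<in>U. f u \<in> V \<and> g (f u) = u) \<and>
           (\<forall>v\<in>V. f (g v) = v)"
proof -
  let ?S = "generalized_jacobian f x0"
  obtain C where lip: "C-lipschitz_on (ball x0 r) f" using assms(12) by blast
  have S: "compact ?S" "?S \<noteq> {}" "\<forall>M\<in>?S. invertible M"
    using compact_generalized_jacobian[OF lip \<open>r > 0\<close>] generalized_jacobian_nonempty[OF lip \<open>r > 0\<close>] assms(9)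
    by (auto simp: maximal_rank_def)
  have "\<delta> > 0" using INF_inverse_matrix_norm_pos[OF S] assms(10) by simp
  have ge: "2 * \<delta> * norm v \<le> norm (M *v v)" if "M \<in> ?S" for M v
  proof -
    have "2 * \<delta> = (INF M\<in>?S. 1 / matrix_norm (matrix_inv M))" using assms(10) by simp
    then show ?thesis using INF_inverse_matrix_norm_le[OF S that, of v] by simp
  qed
  note low = Clarke_lower_bound[OF lip \<open>r > 0\<close> \<open>\<delta> > 0\<close> ge assms(13)]
  have up: "norm (f x - f x0) \<le> (K' + L) * norm (x - x0)" if "x \<in> N" for x
  proof -
    have "norm (f x - f x0) \<le> norm (f0 x - f0 x0) + norm (h x - h x0)"
      using norm_triangle_ineq[of "f0 x - f0 x0" "h x - h x0"] by (simp add: assms(8) algebra_simps)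
    also have "\<dots> \<le> K' * norm (x - x0) + L * norm (x - x0)"
      using assms(5)[rule_format, OF that assms(2)] lipschitz_onD[OF assms(6), of x x0]
      by (intro add_mono) (auto simp: dist_norm)
    finally show ?thesis by (simp add: distrib_right)
  qed
  \<comment> \<open>The lower and upper growth rates are compared at a point other than
    \<open>x0\<close> in both neighbourhoods. The result makes the radius of \<open>U\<close>
    positive and at most half of \<open>r\<close>.\<close>
  have "\<delta> \<le> K' + L"
  proof -
    have "open (N \<inter> ball x0 r)" "x0 \<in> N \<inter> ball x0 r" using assms(1,2) \<open>r > 0\<close> by auto
    moreover from this(1) have "N \<inter> ball x0 r \<noteq> {x0}" using not_open_singleton[of x0] by metis
    ultimately obtain x where x: "x \<in> N" "x \<in> ball x0 r" "x \<noteq> x0" by blast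
    have "\<delta> * norm (x - x0) \<le> norm (f x - f x0)" using low x(2) \<open>r > 0\<close> by simp
    also have "\<dots> \<le> (K' + L) * norm (x - x0)" using up x(1) .
    finally have "\<delta> * norm (x - x0) \<le> (K' + L) * norm (x - x0)" .
    then show ?thesis using x(3) by simp
  qed
  then have KL: "K' + L > 0" using \<open>\<delta> > 0\<close> by simp
  \<comment> \<open>Half the radius keeps the closed ball inside the open ball where the lower bound
    holds, and makes \<open>\<delta> * \<rho>\<close> exactly the radius of
    \<open>V\<close>.\<close>
  define \<rho> where "\<rho> = r / 2"
  have \<rho>: "\<rho> > 0" "\<rho> < r" "\<delta> * \<rho> = r * \<delta> / 2" using \<open>r > 0\<close> by (auto simp: \<rho>_def)
  define R where "R = r * \<delta> / 2 * (1 / (K' + L))"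
  have "R = \<rho> * (\<delta> / (K' + L))" by (simp add: R_def \<rho>_def)
  moreover have "\<delta> / (K' + L) \<le> 1" "\<delta> / (K' + L) > 0"
    using KL \<open>\<delta> \<le> K' + L\<close> \<open>\<delta> > 0\<close> by auto
  ultimately have R: "R > 0" "R \<le> \<rho>"
    using \<rho>(1) mult_left_mono[of "\<delta> / (K' + L)" 1 \<rho>] mult_pos_pos[of \<rho> "\<delta> / (K' + L)"] by auto
  define U where "U = ball x0 R"
  define V where "V = ball (f x0) (r * \<delta> / 2)"
  \<comment> \<open>Injectivity is known only locally, so the inverse is taken relative to the half
    ball.\<close>
  define g where "g = inv_into (ball x0 \<rho>) f"
  have sub: "cball x0 \<rho> \<subseteq> ball x0 r" using \<rho>(2) by auto
  have VU: "V \<subseteq> f ` ball x0 \<rho>"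
    unfolding V_def \<rho>(3)[symmetric]
  proof (rule ball_subset_image_of_expanding[OF _ \<rho>(1) \<open>\<delta> > 0\<close>])
    show "continuous_on (cball x0 \<rho>) f"
      using lipschitz_on_continuous_on[OF lip] sub by (rule continuous_on_subset)
    show "\<delta> * norm (x - y) \<le> norm (f x - f y)" if "x \<in> cball x0 \<rho>" "y \<in> cball x0 \<rho>" for x y
      using that sub by (intro low) auto
  qed
  have inj: "inj_on f (ball x0 \<rho>)"
  proof (rule inj_onI)
    fix x y assume "x \<in> ball x0 \<rho>" "y \<in> ball x0 \<rho>" "f x = f y"
    then have "\<delta> * norm (x - y) \<le> 0" using low[of x y] \<rho>(2) by simp
    then show "x = y" using \<open>\<delta> > 0\<close> by (simp add: mult_le_0_iff)
  qed
  have gV: "g v \<in> ball x0 \<rho>" "f (g v) = v" if "v \<in> V" for v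
    using VU that unfolding g_def by (auto intro: inv_into_into f_inv_into_f simp del: mem_ball)
  have gb: "norm (g a - g b) \<le> 1 / \<delta> * norm (a - b)" if "a \<in> V" "b \<in> V" for a b
    using low[of "g a" "g b"] gV[OF that(1)] gV[OF that(2)] \<rho>(2) \<open>\<delta> > 0\<close> by (simp add: field_simps)
  have "(1 / \<delta>)-lipschitz_on V g"
    using gb \<open>\<delta> > 0\<close> by (intro lipschitz_onI) (auto simp: dist_norm)
  moreover have fV: "f x0 \<in> V" using \<open>r > 0\<close> \<open>\<delta> > 0\<close> by (simp add: V_def)
  \<comment> \<open>A second point of \<open>V\<close> is needed so that the supremum is over a
    nonempty set. Only an upper bound can be expected in general: for the identity, \<delta> is 1/2
    while the inverse has Lipschitz constant 1.\<close>
  moreover have "lipschitz_constant V g \<le> 1 / \<delta>"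
    unfolding lipschitz_constant_def
  proof (rule cSup_least)
    have "open V" by (simp add: V_def)
    then have "V \<noteq> {f x0}" using not_open_singleton[of "f x0"] by metis
    then obtain v where "v \<in> V" "v \<noteq> f x0" using fV by blast
    then show "{norm (g x - g y) / norm (x - y) |x y. x \<in> V \<and> y \<in> V \<and> x \<noteq> y} \<noteq> {}"
      using fV by blast
  next
    fix q assume "q \<in> {norm (g x - g y) / norm (x - y) |x y. x \<in> V \<and> y \<in> V \<and> x \<noteq> y}"
    then obtain a b where ab: "q = norm (g a - g b) / norm (a - b)" "a \<in> V" "b \<in> V" "a \<noteq> b" by blast
    then show "q \<le> 1 / \<delta>" using gb[OF ab(2,3)] by (simp add: divide_le_eq)
  qed
  \<comment> \<open>The radius of \<open>U\<close> is that of \<open>V\<close> divided by the growth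
    bound \<open>K' + L\<close>, valid because \<open>U\<close> lies in \<open>N\<close>; this gives
    \<open>f u \<in> V\<close>. Since \<open>U\<close> also lies in the half ball, \<open>g\<close>
    returns \<open>u\<close> and not another preimage.\<close>
  moreover have "f u \<in> V \<and> g (f u) = u" if "u \<in> U" for u
  proof
    have "u \<in> N" using that assms(14) unfolding U_def R_def by blast
    have "norm (f u - f x0) \<le> (K' + L) * norm (u - x0)" using up[OF \<open>u \<in> N\<close>] .
    also have "\<dots> < (K' + L) * R"
      using that KL by (simp add: U_def dist_norm norm_minus_commute)
    also have "\<dots> = r * \<delta> / 2 * ((K' + L) * (1 / (K' + L)))"
      by (simp only: R_def mult_ac)
    also have "(K' + L) * (1 / (K' + L)) = 1"
      using less_imp_neq[OF KL, symmetric] unfolding divide_inverse mult_1_left by (rule right_inverse)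
    finally have "norm (f u - f x0) < r * \<delta> / 2" by simp
    then show "f u \<in> V" by (simp add: V_def dist_norm norm_minus_commute)
    show "g (f u) = u"
      unfolding g_def using that R(2) by (intro inv_into_f_f[OF inj]) (auto simp: U_def)
  qed
  moreover have "x0 \<in> U" using R(1) by (simp add: U_def)
  ultimately show ?thesis
    using gV(2) unfolding R_def[symmetric]
    by (intro exI[of _ U] exI[of _ V] exI[of _ g]) (auto simp: U_def V_def)
qed

end
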